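(* Let $F$ be a field of characteristic $0$, let $n$ be a positive integer, and let $Z_n$ be the cyclic group of order $n$. If $S \subseteq FZ_n$ is an S-ring over $Z_n$, then $\operatorname{Aut}(S)$ is abelian.
   Context: Let $G$ be a finite group and $F$ a field. For $C \subseteq G$ write $\overline{C} = \sum_{g\in C} g \in FG$ and $C^{(-1)} = \{g^{-1} : g \in C\}$. An S-ring (Schur ring) over $G$ is a subalgebra $S$ of the group algebra $FG$ for which there are disjoint nonempty subsets $T_1,\dots,T_k$ of $G$ such that $\overline{T_1},\dots,\overline{T_k}$ form a basis of $S$, (i) for every $i$ there is $j$ with $T_i^{(-1)} = T_j$, and (ii) $T_1 = \{1\}$ and $G = T_1\cup\cdots\cup T_k$. The $T_i$ are the basic sets of $S$ and the $\overline{T_i}$ its basic quantities. An isomorphism of S-rings is an $F$-algebra isomorphism mapping basic quantities to basic quantities; an automorphism of $S$ is an S-ring isomorphism from $S$ onto itself, and $\operatorname{Aut}(S)$ denotes the group of all automorphisms of $S$. *)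

theory Defs
  imports
    "HOL-Algebra.Algebra"
    "HOL-Library.Function_Algebras"
    "HOL-Library.Indicator_Function"
    "HOL-Library.Disjoint_Sets"
begin

text \<open>
  For a finite group \<open>G\<close> and a field \<open>'f\<close>, the group algebra consists of the functions
  \<open>'a \<Rightarrow> 'f\<close> that vanish outside \<open>carrier G\<close>; such an \<open>f\<close> stands for the formal sum of the
  \<open>f g\<close> times \<open>g\<close>. Addition, zero and the scalar action are pointwise, and the product is
  convolution (not the pointwise product of \<open>Function_Algebras\<close>). All definitions below
  are meant for finite \<open>G\<close>. For \<open>C \<subseteq> carrier G\<close>, the sum of the elements of \<open>C\<close>
  in the group algebra is \<open>indicator C\<close>.
\<close>

definition fscale :: "'f::field \<Rightarrow> ('a \<Rightarrow> 'f) \<Rightarrow> 'a \<Rightarrow> 'f" where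
  "fscale c f = (\<lambda>x. c * f x)"

global_interpretation fvec: vector_space "fscale :: 'f::field \<Rightarrow> ('a \<Rightarrow> 'f) \<Rightarrow> 'a \<Rightarrow> 'f"
  by unfold_locales (simp_all add: fscale_def fun_eq_iff algebra_simps)

definition group_algebra :: "('a, 'm) monoid_scheme \<Rightarrow> ('a \<Rightarrow> 'f::field) ring" where
  "group_algebra G =
    \<lparr>carrier = {f. \<forall>x. x \<notin> carrier G \<longrightarrow> f x = 0},
     monoid.mult = (\<lambda>f g x. \<Sum>(y, z) \<in> {(y, z) \<in> carrier G \<times> carrier G. y \<otimes>\<^bsub>G\<^esub> z = x}. f y * g z),
     monoid.one = indicator {\<one>\<^bsub>G\<^esub>},
     ring.zero = 0,
     ring.add = (+)\<rparr>"

definition schur_partition ::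
    "('a, 'm) monoid_scheme \<Rightarrow> ('a \<Rightarrow> 'f::field) set \<Rightarrow> 'a set set \<Rightarrow> bool" where
  "schur_partition G S T \<longleftrightarrow>
     partition_on (carrier G) T \<and>
     {\<one>\<^bsub>G\<^esub>} \<in> T \<and>
     (\<forall>C\<in>T. m_inv G ` C \<in> T) \<and>
     fvec.independent (indicator ` T :: ('a \<Rightarrow> 'f) set) \<and>
     fvec.span (indicator ` T) = S"

definition schur_ring :: "('a, 'm) monoid_scheme \<Rightarrow> ('a \<Rightarrow> 'f::field) set \<Rightarrow> bool" where
  "schur_ring G S \<longleftrightarrow>
     subring S (group_algebra G) \<and> fvec.subspace S \<and> (\<exists>T. schur_partition G S T)"

text \<open>
  The basic sets are determined by \<open>S\<close>; see \<open>schur_partition_unique\<close> and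
  \<open>schur_partition_basic_sets\<close> below, which justify the definite description.
\<close>

definition basic_sets :: "('a, 'm) monoid_scheme \<Rightarrow> ('a \<Rightarrow> 'f::field) set \<Rightarrow> 'a set set" where
  "basic_sets G S = (THE T. schur_partition G S T)"

definition basic_quantities ::
    "('a, 'm) monoid_scheme \<Rightarrow> ('a \<Rightarrow> 'f::field) set \<Rightarrow> ('a \<Rightarrow> 'f) set" where
  "basic_quantities G S = indicator ` basic_sets G S"

definition schur_iso ::
    "('a, 'm) monoid_scheme \<Rightarrow> ('a \<Rightarrow> 'f::field) set \<Rightarrow>
     ('b, 'k) monoid_scheme \<Rightarrow> ('b \<Rightarrow> 'f) set \<Rightarrow> (('a \<Rightarrow> 'f) \<Rightarrow> 'b \<Rightarrow> 'f) set" where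
  "schur_iso G S H S' =
     {\<phi> \<in> ring_iso ((group_algebra G)\<lparr>carrier := S\<rparr>) ((group_algebra H)\<lparr>carrier := S'\<rparr>).
        (\<forall>c. \<forall>f\<in>S. \<phi> (fscale c f) = fscale c (\<phi> f)) \<and>
        \<phi> ` basic_quantities G S \<subseteq> basic_quantities H S'}"

text \<open>
  As in \<open>BijGroup\<close>, maps are taken to be extensional on \<open>S\<close>, so that each automorphism of \<open>S\<close>
  is represented exactly once; the group operation is composition.
\<close>

definition schur_Aut ::
    "('a, 'm) monoid_scheme \<Rightarrow> ('a \<Rightarrow> 'f::field) set \<Rightarrow> (('a \<Rightarrow> 'f) \<Rightarrow> 'a \<Rightarrow> 'f) monoid" where
  "schur_Aut G S = (BijGroup S)\<lparr>carrier := Bij S \<inter> schur_iso G S G S\<rparr>"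

lemma span_indicator_constant:
  fixes f :: "'a \<Rightarrow> 'f::field"
  assumes T: "partition_on A T" and f: "f \<in> fvec.span (indicator ` T)"
    and C: "C \<in> T" "x \<in> C" "y \<in> C"
  shows "f x = f y"
  using f
proof (induction rule: fvec.span_induct_alt)
  case base
  show ?case by simp
next
  case (step c b g)
  then obtain D where D: "D \<in> T" "b = indicator D" by blast
  have "x \<in> D \<longleftrightarrow> y \<in> D"
    using disjointD[OF partition_onD2[OF T] C(1) D(1)] C by auto
  then show ?case using step D by (simp add: fscale_def indicator_def)
qed

lemma schur_partition_refines:
  fixes S :: "('a \<Rightarrow> 'f::field) set"
  assumes "schur_partition G S T" "schur_partition G S T'" "C \<in> T" "C' \<in> T'" "x \<in> C" "x \<in> C'"
  shows "C' \<subseteq> C"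
proof
  fix y assume y: "y \<in> C'"
  have "(indicator C :: 'a \<Rightarrow> 'f) \<in> S"
    using assms(1) fvec.span_base[OF imageI[OF assms(3), of "indicator :: 'a set \<Rightarrow> 'a \<Rightarrow> 'f"]]
    by (simp add: schur_partition_def)
  then have "(indicator C x :: 'f) = indicator C y"
    using span_indicator_constant[of "carrier G" T' "indicator C :: 'a \<Rightarrow> 'f" C' x y]
      assms y by (simp add: schur_partition_def)
  then show "y \<in> C" using assms(5) by (simp add: indicator_def split: if_splits)
qed

lemma schur_partition_subset:
  fixes S :: "('a \<Rightarrow> 'f::field) set"
  assumes T: "schur_partition G S T" and T': "schur_partition G S T'"
  shows "T \<subseteq> T'"
proof
  fix C assume C: "C \<in> T"
  have P: "partition_on (carrier G) T" "partition_on (carrier G) T'"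
    using T T' by (auto simp: schur_partition_def)
  obtain x where x: "x \<in> C" using partition_onD3[OF P(1)] C by (metis all_not_in_conv)
  then have "x \<in> \<Union>T'" using partition_onD1[OF P(1)] partition_onD1[OF P(2)] C by blast
  then obtain C' where C': "C' \<in> T'" "x \<in> C'" by blast
  have "C = C'"
    using schur_partition_refines[OF T T' C C'(1) x C'(2)]
      schur_partition_refines[OF T' T C'(1) C C'(2) x] by blast
  then show "C \<in> T'" using C' by simp
qed

lemma schur_partition_unique:
  "schur_partition G S T \<Longrightarrow> schur_partition G S T' \<Longrightarrow> T = T'"
  by (intro equalityI schur_partition_subset)

lemma schur_partition_basic_sets:
  "schur_ring G S \<Longrightarrow> schur_partition G S (basic_sets G S)"
proof -
  assume "schur_ring G S"
  then obtain T where T: "schur_partition G S T" by (auto simp: schur_ring_def)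
  show ?thesis
    unfolding basic_sets_def
    by (rule theI[of "schur_partition G S", OF T]) (rule schur_partition_unique[OF _ T])
qed

end

theory Submission
  imports Defs "HOL-Computational_Algebra.Polynomial" "HOL-Number_Theory.Cong"
begin

hide_const (open) Divisibility.prime

text \<open>
  Call a union of basic sets an \<open>S\<close>-set. In characteristic 0 the structure constants are
  integers, so one may compute modulo a prime \<open>p\<close>. If \<open>p\<close> does not divide \<open>n\<close>, the \<open>p\<close>-th power of
  the sum of an \<open>S\<close>-set \<open>C\<close> is congruent to the sum of \<open>{c\<^sup>p | c \<in> C}\<close>; hence every automorphism of
  \<open>S\<close> commutes with the power maps \<open>C \<mapsto> C\<^sup>m\<close> for \<open>m\<close> prime to \<open>n\<close>. It also fixes every subgroup
  that is an \<open>S\<close>-set, since a cyclic group has only one subgroup of each order.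

  The main point is that a basic set of a rational S-ring (one whose basic sets are invariant under all
  these power maps) that lies in no proper \<open>S\<close>-subgroup contains the generators of the group; it is
  proved by induction over \<open>S\<close>-subgroups and quotients, using \<open>p\<close>-th powers for the primes \<open>p\<close>
  dividing \<open>n\<close>. Applied to the power-invariant part of \<open>S\<close>, it shows that an automorphism maps each
  basic set \<open>C\<close> to some \<open>C\<^sup>m\<close> with \<open>m\<close> prime to \<open>n\<close>. As automorphisms commute with the power maps and
  the power maps commute with each other, automorphisms commute.
\<close>

section \<open>Residues, units and gcds\<close>

text \<open>For p dividing n the p-th power map is p to one, and modulo p the p-th power of an S-set
  forgets every fibre that the set fills. Only fibres that are met without being filled survive. In
  a rational S-ring such a fibre lies over an element of order prime to p, because elsewhere a whole
  fibre lies in one orbit of the units; so the surviving part sits in a subgroup of smaller order,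
  and this is what lets the induction descend. The passage from a general S-ring to a rational one
  rests on S-subgroups. An automorphism need not come from a map of the group, but it fixes every
  S-subgroup, so a basic set and its image have the same smallest S-subgroup of the rational part
  above them. The result on generators, applied inside that subgroup, puts both into one basic set
  of the rational part, that is, into one orbit under the power maps. The unit m may vary with C;
  commutation is checked one basic set at a time.\<close>

lemma exists_coprime_lift:
  fixes a k n :: int
  assumes "coprime a k" "n \<noteq> 0"
  shows "\<exists>j. coprime (a + k * j) n"
proof -
  \<comment> \<open>A prime factor of n divides exactly one of a and k * j: one dividing a divides
    neither k, by coprimality, nor j, which is built from the other primes.\<close>
  define j where "j = \<Prod>{q \<in> prime_factors n. \<not> q dvd a}"
  have "coprime (a + k * j) n"
  proof (rule ccontr)
    assume "\<not> coprime (a + k * j) n"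
    then have "\<not> is_unit (gcd (a + k * j) n)" by (simp only: is_unit_gcd not_False_eq_True)
    then obtain q where "prime q" "q dvd gcd (a + k * j) n"
      using prime_divisor_exists[of "gcd (a + k * j) n"] assms(2) by auto
    then have q: "prime q" "q dvd a + k * j" "q dvd n" by simp_all
    show False
    proof (cases "q dvd a")
      case True
      then have "q dvd k * j"
        using q(2) by (simp add: dvd_add_right_iff)
      moreover have "\<not> q dvd k"
        using True assms(1) q(1) by (meson coprime_common_divisor not_prime_unit)
      moreover have "\<not> q dvd j"
      proof
        assume "q dvd j"
        then obtain r where "r \<in> {q \<in> prime_factors n. \<not> q dvd a}" "q dvd r"
          unfolding j_def using q(1) by (subst (asm) prime_dvd_prod_iff) auto
        then show False
          using q(1) True by (auto simp: in_prime_factors_iff dest: primes_dvd_imp_eq)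
      qed
      ultimately show False using q(1) by (simp add: prime_dvd_mult_iff)
    next
      case False
      then have "q \<in> {q \<in> prime_factors n. \<not> q dvd a}"
        using q assms(2) by (simp add: in_prime_factors_iff)
      then have "q dvd j" unfolding j_def by (intro dvd_prodI) auto
      then have "q dvd a" using q(2) by (simp add: dvd_add_left_iff)
      then show False using False by simp
    qed
  qed
  then show ?thesis by blast
qed

text \<open>Division by \<open>gcd x m\<close> reduces this to lifting a unit. It makes quotients of
  rational families rational: invariance modulo m is tested at representatives whose gcd with n is
  the right one.\<close>

lemma gcd_lift:
  fixes x m n :: int
  assumes "m dvd n" "n > 0"
  shows "\<exists>y. y mod m = x mod m \<and> gcd y n = gcd x m"
proof -
  define d where "d = gcd x m"
  have "m \<noteq> 0" using assms by auto
  then have d: "d > 0" by (simp add: d_def)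
  obtain a k where ak: "x = d * a" "m = d * k" "coprime a k"
    using gcd_coprime_exists[of x m] \<open>m \<noteq> 0\<close> unfolding d_def by (auto simp: ac_simps)
  obtain e where e: "n = d * e" using assms(1) ak(2) by (metis dvd_def dvd_mult_left)
  then have "e \<noteq> 0" using assms(2) by auto
  then obtain j where j: "coprime (a + k * j) e"
    using exists_coprime_lift[OF ak(3)] by blast
  have "gcd (d * (a + k * j)) n = d"
    using j d by (simp add: e gcd_mult_distrib_int[symmetric] coprime_iff_gcd_eq_1)
  moreover have "d * (a + k * j) = x + j * m" by (simp add: ak(1,2) algebra_simps)
  ultimately show ?thesis
    by (intro exI[of _ "x + j * m"]) (simp add: d_def)
qed

text \<open>Divided by their common gcd d with n, both x and y are units modulo n / d; their
  quotient there lifts to a unit modulo n. The classes of equal gcd are thus the orbits of the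
  units, which is how invariance under power maps is encoded below.\<close>

lemma gcd_eq_imp_unit_multiple:
  fixes x y n :: int
  assumes "gcd x n = gcd y n" "n > 0"
  shows "\<exists>u>0. coprime u n \<and> (u * x) mod n = y mod n"
proof -
  define d where "d = gcd x n"
  have d: "d > 0" using assms by (simp add: d_def)
  obtain a k where ak: "x = d * a" "n = d * k" "coprime a k"
    using gcd_coprime_exists[of x n] assms(2) unfolding d_def by (auto simp: ac_simps)
  obtain b where b: "y = d * b" "coprime b k"
  proof -
    obtain b k' where "y = b * d" "n = k' * d" "coprime b k'"
      using gcd_coprime_exists[of y n] assms unfolding d_def by auto
    then show ?thesis using that[of b] d ak(2) by (simp add: mult.commute)
  qed
  have "k > 0" using d assms(2) ak(2) by (simp add: zero_less_mult_iff)
  obtain a' where a': "[a * a' = 1] (mod k)" using ak(3) cong_solve_coprime_int by blast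
  have "coprime a' k"
    using a' by (metis cong_imp_coprime cong_sym coprime_1_left coprime_mult_left_iff)
  then have "coprime (b * a') k" using b(2) by simp
  then obtain j where j: "coprime (b * a' + k * j) n"
    using exists_coprime_lift assms(2) by (metis less_irrefl)
  define v where "v = b * a' + k * j"
  define u where "u = v mod n + n"
  have u: "u > 0" "coprime u n" "u mod n = v mod n"
    using assms(2) j pos_mod_sign[of n v]
    by (simp_all add: u_def v_def add_nonneg_pos coprime_iff_gcd_eq_1 del: coprime_imp_gcd_eq_1)
  have "[v * a = b] (mod k)"
  proof -
    have "v * a - b = b * (a * a' - 1) + k * (j * a)" by (simp add: v_def algebra_simps)
    moreover have "k dvd a * a' - 1" using a' by (simp add: cong_iff_dvd_diff)
    ultimately show ?thesis by (simp add: cong_iff_dvd_diff)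
  qed
  then have "d * k dvd d * (v * a - b)" by (simp add: cong_iff_dvd_diff)
  then have "n dvd v * x - y" by (simp add: ak b algebra_simps)
  then have "(u * x) mod n = y mod n"
    using u(3) by (metis mod_eq_dvd_iff mod_mult_left_eq)
  then show ?thesis using u by blast
qed

text \<open>Periodicity supplies negatives, as -x is congruent to (n - 1) * x. So D is a subgroup of
  the integers containing n, generated by its least positive element.\<close>

lemma periodic_additive_set:
  fixes D :: "int set"
  assumes n: "n > 0" and per: "\<And>x y. x \<in> D \<Longrightarrow> x mod n = y mod n \<Longrightarrow> y \<in> D"
    and D0: "0 \<in> D" and add: "\<And>x y. x \<in> D \<Longrightarrow> y \<in> D \<Longrightarrow> x + y \<in> D"
  shows "\<exists>k>0. k dvd n \<and> (\<forall>x. x \<in> D \<longleftrightarrow> k dvd x)"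
proof -
  have nat_mult: "int j * x \<in> D" if "x \<in> D" for j x
  proof (induction j)
    case (Suc j)
    then show ?case using add[OF that Suc] by (simp add: distrib_right)
  qed (use D0 in simp)
  have neg: "- x \<in> D" if "x \<in> D" for x
  proof (rule per[OF nat_mult[OF that, of "nat (n - 1)"]])
    have eq: "int (nat (n - 1)) * x = - x + x * n" using n by (simp add: algebra_simps)
    show "int (nat (n - 1)) * x mod n = - x mod n" unfolding eq by (rule mod_mult_self1)
  qed
  have int_mult: "j * x \<in> D" if "x \<in> D" for j x
  proof (cases "j \<ge> 0")
    case True
    then show ?thesis using nat_mult[OF that, of "nat j"] by simp
  next
    case False
    then show ?thesis using neg[OF nat_mult[OF that, of "nat (- j)"]] by simp
  qed
  have nD: "n \<in> D" by (rule per[OF D0]) simp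
  define k where "k = int (LEAST k. k > 0 \<and> int k \<in> D)"
  have "k > 0 \<and> k \<in> D"
    unfolding k_def using LeastI[of "\<lambda>k. k > 0 \<and> int k \<in> D" "nat n"] n nD by simp
  then have k: "k > 0" "k \<in> D" by auto
  have least: "k \<le> x" if "x > 0" "x \<in> D" for x
    unfolding k_def using Least_le[of "\<lambda>k. k > 0 \<and> int k \<in> D" "nat x"] that by simp
  have *: "x \<in> D \<longleftrightarrow> k dvd x" for x
  proof
    assume "x \<in> D"
    then have "x + (- (x div k)) * k \<in> D" by (intro add int_mult k)
    moreover have "x + (- (x div k)) * k = x mod k" using div_mult_mod_eq[of x k] by linarith
    ultimately have "x mod k \<in> D" by simp
    then show "k dvd x"
      using least[of "x mod k"] pos_mod_sign[OF k(1), of x] pos_mod_bound[OF k(1), of x]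
      unfolding dvd_eq_mod_eq_0 by linarith
  next
    assume "k dvd x"
    then obtain j where "x = j * k" by (auto simp: dvd_def mult.commute)
    then show "x \<in> D" using int_mult[OF k(2)] by simp
  qed
  show ?thesis using k * nD by blast
qed

section \<open>Cyclic convolution and prime powers\<close>

definition conv :: "int \<Rightarrow> (int \<Rightarrow> int) \<Rightarrow> (int \<Rightarrow> int) \<Rightarrow> int \<Rightarrow> int" where
  "conv n f g x = (\<Sum>i\<in>{0..<n}. f i * g (x - i))"

primrec conv_pow :: "int \<Rightarrow> (int \<Rightarrow> int) \<Rightarrow> nat \<Rightarrow> int \<Rightarrow> int" where
  "conv_pow n f 0 = (\<lambda>x. of_bool (n dvd x))"
| "conv_pow n f (Suc k) = conv n f (conv_pow n f k)"

definition periodic :: "int \<Rightarrow> (int \<Rightarrow> 'b) \<Rightarrow> bool" where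
  "periodic n f \<longleftrightarrow> (\<forall>x y. x mod n = y mod n \<longrightarrow> f x = f y)"

lemma periodicI: "(\<And>x y. x mod n = y mod n \<Longrightarrow> f x = f y) \<Longrightarrow> periodic n f"
  unfolding periodic_def by blast

lemma periodicD: "periodic n f \<Longrightarrow> x mod n = y mod n \<Longrightarrow> f x = f y"
  unfolding periodic_def by blast

section \<open>Sums over a full period\<close>

lemma sum_periodic_reindex:
  fixes H :: "int \<Rightarrow> int"
  assumes n: "n > 0" and H: "periodic n H"
    and w: "\<And>i j. w i mod n = w j mod n \<Longrightarrow> i mod n = j mod n"
  shows "(\<Sum>i\<in>{0..<n}. H (w i)) = (\<Sum>i\<in>{0..<n}. H i)"
proof -
  have inj: "inj_on (\<lambda>i. w i mod n) {0..<n}"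
  proof (rule inj_onI)
    fix i j assume ij: "i \<in> {0..<n}" "j \<in> {0..<n}" "w i mod n = w j mod n"
    show "i = j" using w[OF ij(3)] ij(1,2) by simp
  qed
  have "(\<lambda>i. w i mod n) ` {0..<n} = {0..<n}"
    by (rule endo_inj_surj) (use n inj in auto)
  then have bij: "bij_betw (\<lambda>i. w i mod n) {0..<n} {0..<n}"
    using inj by (simp add: bij_betw_def)
  have "(\<Sum>i\<in>{0..<n}. H (w i)) = (\<Sum>i\<in>{0..<n}. H (w i mod n))"
    by (intro sum.cong refl periodicD[OF H]) simp
  also have "\<dots> = (\<Sum>i\<in>{0..<n}. H i)"
    by (rule sum.reindex_bij_betw[OF bij])
  finally show ?thesis .
qed

lemma sum_periodic_shift:
  fixes H :: "int \<Rightarrow> int"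
  assumes "n > 0" "periodic n H"
  shows "(\<Sum>i\<in>{0..<n}. H (i + c)) = (\<Sum>i\<in>{0..<n}. H i)"
  by (rule sum_periodic_reindex[OF assms]) (simp add: mod_eq_dvd_iff)

lemma sum_of_bool_residue:
  fixes F :: "int \<Rightarrow> int"
  assumes n: "n > 0" and F: "periodic n F"
  shows "(\<Sum>i\<in>{0..<n}. of_bool (n dvd i - x) * F i) = F x"
proof -
  have "(\<Sum>i\<in>{0..<n}. of_bool (n dvd i - x) * F i) = (\<Sum>i\<in>{x mod n}. of_bool (n dvd i - x) * F i)"
  proof (rule sum.mono_neutral_right)
    show "\<forall>i\<in>{0..<n} - {x mod n}. of_bool (n dvd i - x) * F i = 0"
      by (auto simp: mod_eq_dvd_iff[symmetric])
  qed (use n in auto)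
  also have "\<dots> = F x"
    using periodicD[OF F, of "x mod n" x] by (simp add: mod_eq_dvd_iff[symmetric])
  finally show ?thesis .
qed

text \<open>The ring homomorphism from \<open>\<int>[X]\<close> onto the integral group ring of \<open>\<int>/n\<close>.\<close>

definition fold_poly :: "int \<Rightarrow> int poly \<Rightarrow> int \<Rightarrow> int" where
  "fold_poly n P x = (\<Sum>i\<le>degree P. coeff P i * of_bool (n dvd x - int i))"

lemma fold_poly_bound:
  assumes "degree P \<le> N"
  shows "fold_poly n P x = (\<Sum>i\<le>N. coeff P i * of_bool (n dvd x - int i))"
  unfolding fold_poly_def
  by (rule sum.mono_neutral_left) (use assms in \<open>auto simp: coeff_eq_0\<close>)

lemma fold_poly_add: "fold_poly n (P + Q) x = fold_poly n P x + fold_poly n Q x"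
proof -
  define N where "N = max (degree P) (degree Q)"
  have "degree (P + Q) \<le> N" by (simp add: N_def degree_add_le_max)
  then show ?thesis
    by (simp add: fold_poly_bound[where N = N] N_def algebra_simps sum.distrib)
qed

lemma fold_poly_smult: "fold_poly n (smult c P) x = c * fold_poly n P x"
  using fold_poly_bound[OF degree_smult_le, of n c P x]
  by (simp add: fold_poly_def[of n P] sum_distrib_left mult.assoc del: degree_smult_eq sum_mult_of_bool_eq)

lemma fold_poly_0 [simp]: "fold_poly n 0 x = 0"
  by (simp add: fold_poly_def)

lemma fold_poly_sum: "fold_poly n (\<Sum>i\<in>A. P i) x = (\<Sum>i\<in>A. fold_poly n (P i) x)"
  by (induction A rule: infinite_finite_induct) (simp_all add: fold_poly_add)

lemma fold_poly_monom: "fold_poly n (monom c k) x = c * of_bool (n dvd x - int k)"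
proof -
  have "fold_poly n (monom c k) x = (\<Sum>i\<le>k. coeff (monom c k) i * of_bool (n dvd x - int i))"
    by (rule fold_poly_bound) (rule degree_monom_le)
  also have "\<dots> = (\<Sum>i\<in>{k}. coeff (monom c k) i * of_bool (n dvd x - int i))"
    by (rule sum.mono_neutral_right) auto
  finally show ?thesis by simp
qed

lemma fold_poly_pCons:
  "fold_poly n (pCons a P) x = a * of_bool (n dvd x) + fold_poly n P (x - 1)"
proof -
  have "fold_poly n (pCons a P) x =
      (\<Sum>i\<le>Suc (degree P). coeff (pCons a P) i * of_bool (n dvd x - int i))"
    by (rule fold_poly_bound) (rule degree_pCons_le)
  also have "\<dots> = a * of_bool (n dvd x) + fold_poly n P (x - 1)"
    by (subst sum.atMost_Suc_shift) (simp add: fold_poly_def algebra_simps)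
  finally show ?thesis .
qed

lemma periodic_fold_poly: "periodic n (fold_poly n P)"
  unfolding periodic_def
proof (intro allI impI)
  fix x y assume "x mod n = y mod n"
  then have "n dvd x - int i \<longleftrightarrow> n dvd y - int i" for i
    by (metis mod_diff_left_eq mod_eq_dvd_iff diff_diff_eq2 mod_eq_0_iff_dvd)
  then show "fold_poly n P x = fold_poly n P y" by (simp add: fold_poly_def)
qed

lemma periodic_conv_summand:
  fixes f g :: "int \<Rightarrow> int"
  assumes "periodic n f" "periodic n g"
  shows "periodic n (\<lambda>i. f i * g (x - i))"
  unfolding periodic_def
proof (intro allI impI)
  fix i j assume ij: "i mod n = j mod n"
  then have "(x - i) mod n = (x - j) mod n" by (rule mod_diff_cong[OF refl])
  then show "f i * g (x - i) = f j * g (x - j)"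
    using periodicD[OF assms(1) ij] periodicD[OF assms(2)] by metis
qed

text \<open>Multiplication by X becomes a shift by 1, under which sums over a period are
  invariant.\<close>

lemma fold_poly_mult:
  assumes n: "n > 0"
  shows "fold_poly n (P * Q) x = conv n (fold_poly n P) (fold_poly n Q) x"
proof (induction P arbitrary: x)
  case 0
  show ?case by (simp add: conv_def)
next
  case (pCons a P)
  let ?F = "fold_poly n P" and ?G = "fold_poly n Q"
  have "conv n (fold_poly n (pCons a P)) ?G x =
      (\<Sum>i\<in>{0..<n}. of_bool (n dvd i - 0) * (a * ?G (x - i))) +
      (\<Sum>i\<in>{0..<n}. ?F (i + - 1) * ?G ((x - 1) - (i + - 1)))"
    by (simp add: conv_def fold_poly_pCons algebra_simps sum.distrib)
  also have "(\<Sum>i\<in>{0..<n}. of_bool (n dvd i - 0) * (a * ?G (x - i))) = a * ?G (x - 0)"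
    by (rule sum_of_bool_residue[OF n])
      (rule periodic_conv_summand[of n "\<lambda>_. a" ?G x, OF _ periodic_fold_poly], simp add: periodic_def)
  also have "(\<Sum>i\<in>{0..<n}. ?F (i + - 1) * ?G ((x - 1) - (i + - 1))) = conv n ?F ?G (x - 1)"
    unfolding conv_def
    by (rule sum_periodic_shift[OF n, where H = "\<lambda>i. ?F i * ?G ((x - 1) - i)"])
      (intro periodic_conv_summand periodic_fold_poly)
  finally show ?case
    unfolding mult_pCons_left fold_poly_add fold_poly_smult fold_poly_pCons[of n 0] pCons.IH
    by simp
qed

section \<open>p-th powers modulo p\<close>

lemma prime_dvd_power_add:
  fixes a b :: "'b::comm_ring_1"
  assumes "prime p"
  shows "of_nat p dvd (a + b) ^ p - (a ^ p + b ^ p)"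
proof -
  have p: "p > 0" using assms prime_gt_0_nat by blast
  have "(a + b) ^ p = (\<Sum>k\<le>p. of_nat (p choose k) * a ^ k * b ^ (p - k))"
    by (rule binomial_ring)
  also have "{..p} = insert 0 (insert p {0<..<p})" using p by auto
  also have "(\<Sum>k\<in>insert 0 (insert p {0<..<p}). of_nat (p choose k) * a ^ k * b ^ (p - k)) =
      b ^ p + a ^ p + (\<Sum>k\<in>{0<..<p}. of_nat (p choose k) * a ^ k * b ^ (p - k))"
    using p by (simp add: algebra_simps)
  finally have "(a + b) ^ p - (a ^ p + b ^ p) =
      (\<Sum>k\<in>{0<..<p}. of_nat (p choose k) * a ^ k * b ^ (p - k))" by simp
  also have "of_nat p dvd \<dots>"
  proof (rule dvd_sum)
    fix k assume "k \<in> {0<..<p}"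
    then have "p dvd p choose k" using assms by (intro dvd_choose_prime) auto
    then show "(of_nat p :: 'b) dvd of_nat (p choose k) * a ^ k * b ^ (p - k)"
      by (auto simp: dvd_def mult.assoc)
  qed
  finally show ?thesis .
qed

lemma prime_dvd_power_sum:
  fixes f :: "'c \<Rightarrow> 'b::comm_ring_1"
  assumes "prime p"
  shows "of_nat p dvd (\<Sum>i\<in>A. f i) ^ p - (\<Sum>i\<in>A. f i ^ p)"
proof (induction A rule: infinite_finite_induct)
  case (insert x A)
  have "of_nat p dvd ((f x + sum f A) ^ p - (f x ^ p + sum f A ^ p)) +
      (sum f A ^ p - (\<Sum>i\<in>A. f i ^ p))"
    by (intro dvd_add prime_dvd_power_add assms insert.IH)
  then show ?case using insert.hyps by (simp add: algebra_simps)
qed (use assms prime_gt_0_nat in \<open>auto simp: zero_power\<close>)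

text \<open>The binomial argument takes place in the commutative ring \<open>int poly\<close> and is
  pushed down by \<open>fold_poly\<close>. Coefficients 0 and 1 equal their p-th powers, so raising
  a monomial to the power p only multiplies its exponent.\<close>

lemma conv_pow_prime:
  assumes n: "n > 0" and f: "periodic n f" and f01: "\<And>x. f x \<in> {0, 1}" and p: "prime p"
  shows "int p dvd conv_pow n f p x - (\<Sum>i\<in>{0..<n}. f i * of_bool (n dvd x - int p * i))"
proof -
  define P where "P = (\<Sum>i\<in>{0..<n}. monom (f i) (nat i))"
  have fold_P: "fold_poly n P = f"
  proof
    fix x
    have "fold_poly n P x = (\<Sum>i\<in>{0..<n}. of_bool (n dvd i - x) * f i)"
      unfolding P_def fold_poly_sum
      by (intro sum.cong refl) (auto simp: fold_poly_monom dvd_diff_commute)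
    then show "fold_poly n P x = f x" using sum_of_bool_residue[OF n f] by simp
  qed
  have pow: "conv_pow n f k x = fold_poly n (P ^ k) x" for k x
  proof (induction k arbitrary: x)
    case 0
    show ?case using fold_poly_monom[of n 1 0 x] by (simp add: monom_0 one_pCons)
  next
    case (Suc k)
    show ?case by (simp add: fold_poly_mult[OF n] fold_P Suc.IH conv_def)
  qed
  obtain Q where Q: "P ^ p - (\<Sum>i\<in>{0..<n}. monom (f i) (nat i) ^ p) = of_nat p * Q"
    using prime_dvd_power_sum[OF p, of "\<lambda>i. monom (f i) (nat i)" "{0..<n}"]
    unfolding P_def dvd_def by blast
  have "f i ^ p = f i" for i using f01[of i] p prime_gt_0_nat[of p] by (auto simp: zero_power)
  then have "P ^ p = (\<Sum>i\<in>{0..<n}. monom (f i) (nat i * p)) + smult (int p) Q"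
    using Q by (simp add: monom_power algebra_simps of_nat_poly)
  then have "conv_pow n f p x =
      (\<Sum>i\<in>{0..<n}. f i * of_bool (n dvd x - int p * i)) + int p * fold_poly n Q x"
    by (simp add: pow fold_poly_add fold_poly_smult fold_poly_sum fold_poly_monom mult.commute)
  then show ?thesis by simp
qed

lemma sum_periodic_multiple:
  fixes H :: "int \<Rightarrow> int"
  assumes m: "m > 0" and H: "periodic m H" and n: "m dvd n" "n \<ge> 0"
  shows "(\<Sum>i\<in>{0..<n}. H i) = n div m * (\<Sum>i\<in>{0..<m}. H i)"
proof -
  have *: "(\<Sum>i\<in>{0..<int k * m}. H i) = int k * (\<Sum>i\<in>{0..<m}. H i)" for k
  proof (induction k)
    case (Suc k)
    have per: "H (i - int k * m) = H i" for i
      by (rule periodicD[OF H]) (simp add: mod_eq_dvd_iff)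
    have "{0..<int (Suc k) * m} = {0..<int k * m} \<union> {int k * m..<int k * m + m}"
    proof -
      have "0 \<le> m * int k" using m by simp
      from order_trans[OF this] show ?thesis using m by (auto simp: algebra_simps)
    qed
    then have "(\<Sum>i\<in>{0..<int (Suc k) * m}. H i) =
        (\<Sum>i\<in>{0..<int k * m}. H i) + (\<Sum>i\<in>{int k * m..<int k * m + m}. H i)"
      by (simp add: sum.union_disjoint)
    also have "(\<Sum>i\<in>{int k * m..<int k * m + m}. H i) = (\<Sum>i\<in>{0..<m}. H i)"
      by (rule sum.reindex_bij_witness[of _ "\<lambda>i. i + int k * m" "\<lambda>i. i - int k * m"])
        (auto simp: per)
    finally show ?case using Suc by (simp add: algebra_simps)
  qed simp
  obtain k where k: "n = m * k" using n(1) by blast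
  then have "k \<ge> 0" using m n(2) by (simp add: zero_le_mult_iff)
  then show ?thesis using *[of "nat k"] k m by (simp add: mult.commute)
qed

lemma card_residue_class:
  fixes m n z :: int
  assumes "m dvd n" "m > 0" "n \<ge> 0"
  shows "(\<Sum>i\<in>{0..<n}. of_bool (m dvd i - z)) = n div m"
proof -
  have p: "periodic m (\<lambda>i. of_bool (m dvd i - z) :: int)"
  proof (rule periodicI)
    fix x y assume "x mod m = y mod m"
    then show "(of_bool (m dvd x - z) :: int) = of_bool (m dvd y - z)"
      using mod_diff_cong[of x m y z z] by (simp add: dvd_eq_mod_eq_0)
  qed
  have "(\<Sum>i\<in>{0..<n}. of_bool (m dvd i - z)) = n div m * (\<Sum>i\<in>{0..<m}. of_bool (m dvd i - z) * 1)"
    unfolding mult_1_right by (rule sum_periodic_multiple[OF assms(2) p assms(1,3)])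
  also have "(\<Sum>i\<in>{0..<m}. of_bool (m dvd i - z) * 1) = (1 :: int)"
    by (rule sum_of_bool_residue[OF assms(2)]) (rule periodicI, rule refl)
  finally show ?thesis by simp
qed

section \<open>Families of functions on the integers closed under convolution\<close>

text \<open>
  Abstract form of the integer-valued elements of an S-ring over \<open>\<int>/n\<close>, seen as \<open>n\<close>-periodic
  functions on \<open>\<int>\<close>. Closure under arbitrary pointwise operations says that these are exactly the
  functions constant on the classes of some partition. Working on \<open>\<int>\<close> makes the quotient by the
  subgroup of multiples of \<open>m\<close> just the subfamily of \<open>m\<close>-periodic functions.
\<close>

locale schur_family =
  fixes n :: int and M :: "(int \<Rightarrow> int) set"
  assumes n_pos: "n > 0"
    and periodic: "f \<in> M \<Longrightarrow> periodic n f"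
    and pointwise2: "f \<in> M \<Longrightarrow> g \<in> M \<Longrightarrow> (\<lambda>x. F (f x) (g x)) \<in> M"
    and identity: "(\<lambda>x. of_bool (n dvd x)) \<in> M"
    and conv: "f \<in> M \<Longrightarrow> g \<in> M \<Longrightarrow> conv n f g \<in> M"
begin

text \<open>The S-sets, viewed as n-periodic predicates on the integers.\<close>

definition meas :: "(int \<Rightarrow> bool) \<Rightarrow> bool" where
  "meas P \<longleftrightarrow> (\<lambda>x. of_bool (P x)) \<in> M"

lemma pointwise: "f \<in> M \<Longrightarrow> (\<lambda>x. F (f x)) \<in> M"
  using pointwise2[of f f "\<lambda>a b. F a"] by simp

lemma meas_fun: "f \<in> M \<Longrightarrow> meas (\<lambda>x. Q (f x))"
  unfolding meas_def by (rule pointwise)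

lemma meas_binop:
  assumes "meas P" "meas Q"
  shows "meas (\<lambda>x. F (P x) (Q x))"
  using pointwise2[of _ _ "\<lambda>a b. of_bool (F (a = 1) (b = 1))", OF assms[unfolded meas_def]]
  by (simp add: meas_def)

lemma meas_const: "meas (\<lambda>_. b)"
  using pointwise[OF identity, of "\<lambda>_. of_bool b"] by (simp add: meas_def)

lemma meas_dvd_n: "meas ((dvd) n)"
  using identity by (simp add: meas_def)

lemma meas_periodic: "meas P \<Longrightarrow> periodic n P"
  unfolding meas_def by (rule periodicI) (metis periodicD[OF periodic] of_bool_eq_iff)

lemma meas_mod: "meas P \<Longrightarrow> P (x mod n) \<longleftrightarrow> P x"
  using periodicD[OF meas_periodic, of P "x mod n" x] by simp

lemma meas_finite_Ball: "finite A \<Longrightarrow> (\<And>a. a \<in> A \<Longrightarrow> meas (P a)) \<Longrightarrow> meas (\<lambda>x. \<forall>a\<in>A. P a x)"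
proof (induction A rule: finite_induct)
  case (insert a A)
  then show ?case using meas_binop[of "P a" "\<lambda>x. \<forall>a\<in>A. P a x" "(\<and>)"] by simp
qed (simp add: meas_const)

lemma meas_finite_Bex:
  assumes "finite A" "\<And>a. a \<in> A \<Longrightarrow> meas (P a)"
  shows "meas (\<lambda>x. \<exists>a\<in>A. P a x)"
proof -
  have "meas (\<lambda>x. \<not> P a x)" if "a \<in> A" for a
    using meas_binop[OF assms(2) assms(2), OF that that, of "\<lambda>a b. \<not> a"] by simp
  then have "meas (\<lambda>x. \<forall>a\<in>A. \<not> P a x)" by (rule meas_finite_Ball[OF assms(1)])
  from meas_binop[OF this this, of "\<lambda>a b. \<not> a"] show ?thesis by simp
qed

text \<open>The convolution of two indicators counts representations as a sum, so its support is the
  sum set.\<close>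

lemma meas_sum:
  assumes "meas P" "meas Q"
  shows "meas (\<lambda>z. \<exists>x. P x \<and> Q (z - x))"
proof -
  have "(\<exists>x. P x \<and> Q (z - x)) \<longleftrightarrow> conv n (\<lambda>x. of_bool (P x)) (\<lambda>x. of_bool (Q x)) z \<noteq> 0" for z
  proof -
    have "(\<exists>x. P x \<and> Q (z - x)) \<longleftrightarrow> (\<exists>i\<in>{0..<n}. P i \<and> Q (z - i))"
    proof
      assume "\<exists>x. P x \<and> Q (z - x)"
      then obtain x where x: "P x" "Q (z - x)" by blast
      have "Q (z - x mod n)"
        using x(2) periodicD[OF meas_periodic[OF assms(2)], of "z - x mod n" "z - x"]
        by (simp add: mod_diff_right_eq)
      then have "P (x mod n) \<and> Q (z - x mod n)" using x(1) meas_mod[OF assms(1)] by simp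
      then show "\<exists>i\<in>{0..<n}. P i \<and> Q (z - i)" using n_pos by (intro bexI[of _ "x mod n"]) auto
    qed blast
    also have "\<dots> \<longleftrightarrow> conv n (\<lambda>x. of_bool (P x)) (\<lambda>x. of_bool (Q x)) z \<noteq> 0"
      unfolding conv_def by (subst sum_nonneg_eq_0_iff) auto
    finally show ?thesis .
  qed
  then show ?thesis
    using meas_fun[OF conv[OF assms[unfolded meas_def]], of "\<lambda>v. v \<noteq> 0"] by simp
qed

lemma meas_gcd_dvd:
  assumes "meas ((dvd) k)" "meas ((dvd) l)"
  shows "meas ((dvd) (gcd k l))"
proof -
  have "(\<exists>x. k dvd x \<and> l dvd z - x) \<longleftrightarrow> gcd k l dvd z" for z
  proof
    assume "\<exists>x. k dvd x \<and> l dvd z - x"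
    then obtain x where "k dvd x" "l dvd z - x" by blast
    then have "gcd k l dvd x + (z - x)" by (intro dvd_add) (auto intro: dvd_trans)
    then show "gcd k l dvd z" by simp
  next
    assume "gcd k l dvd z"
    then obtain c where c: "z = gcd k l * c" by blast
    obtain u v where "u * k + v * l = gcd k l" using bezout_int by blast
    then have "z - u * c * k = l * (v * c)" unfolding c
      by (metis add_diff_cancel_left' distrib_right mult.assoc mult.commute)
    then show "\<exists>x. k dvd x \<and> l dvd z - x" by (intro exI[of _ "u * c * k"]) simp
  qed
  then have "(\<lambda>z. \<exists>x. k dvd x \<and> l dvd z - x) = (dvd) (gcd k l)" by (intro ext)
  then show ?thesis using meas_sum[OF assms] by simp
qed

text \<open>The basic set of x, recovered from the functions because the locale carries no
  partition.\<close>

definition cell :: "int \<Rightarrow> int \<Rightarrow> bool" where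
  "cell x y \<longleftrightarrow> (\<forall>f\<in>M. f y = f x)"

lemma cell_refl: "cell x x"
  by (simp add: cell_def)

lemma cell_meas: "cell x y \<Longrightarrow> meas P \<Longrightarrow> P x \<longleftrightarrow> P y"
  unfolding cell_def meas_def by force

text \<open>By periodicity finitely many separating functions suffice, so the cell is a finite
  intersection of level sets.\<close>

lemma meas_cell: "meas (cell x)"
proof -
  \<comment> \<open>For y inside the cell the requirement is vacuous and \<open>identity\<close>
    serves as a default.\<close>
  have "\<exists>g\<in>M. \<not> cell x y \<longrightarrow> g y \<noteq> g x" for y
    using identity by (auto simp: cell_def)
  then obtain g where g: "\<And>y. g y \<in> M" "\<And>y. \<not> cell x y \<Longrightarrow> g y y \<noteq> g y x" by metis
  have "cell x z \<longleftrightarrow> (\<forall>y\<in>{0..<n}. g y z = g y x)" for z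
  proof
    assume "\<forall>y\<in>{0..<n}. g y z = g y x"
    then have "g (z mod n) z = g (z mod n) x" using n_pos by simp
    moreover have "g (z mod n) z = g (z mod n) (z mod n)"
      by (rule periodicD[OF periodic[OF g(1)]]) simp
    ultimately have "cell x (z mod n)" using g(2)[of "z mod n"] by metis
    then show "cell x z"
      unfolding cell_def using periodicD[OF periodic, of _ "z mod n" z] by (metis mod_mod_trivial)
  qed (use g in \<open>simp add: cell_def\<close>)
  then have "cell x = (\<lambda>z. \<forall>y\<in>{0..<n}. g y z = g y x)" by (intro ext)
  moreover have "meas (\<lambda>z. \<forall>y\<in>{0..<n}. g y z = g y x)"
    by (intro meas_finite_Ball finite_atLeastLessThan_int meas_fun g(1))
  ultimately show ?thesis by simp
qed

lemma conv_pow_closed: "f \<in> M \<Longrightarrow> conv_pow n f k \<in> M"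
  by (induction k) (simp_all add: identity conv)

text \<open>
  Modulo a prime \<open>p\<close> this is the \<open>p\<close>-fold convolution power of the indicator of \<open>P\<close>.
\<close>

definition frob :: "int \<Rightarrow> (int \<Rightarrow> bool) \<Rightarrow> int \<Rightarrow> int" where
  "frob p P x = (\<Sum>i\<in>{0..<n}. of_bool (P i \<and> n dvd x - p * i))"

lemma conv_pow_frob:
  assumes "meas P" "prime p"
  shows "p dvd conv_pow n (\<lambda>x. of_bool (P x)) (nat p) x - frob p P x"
proof -
  have "p \<ge> 0" "prime (nat p)" using assms(2) by (simp_all add: prime_ge_0_int)
  then show ?thesis
    using conv_pow_prime[OF n_pos periodic[OF assms(1)[unfolded meas_def]], of "nat p" x]
    by (simp add: frob_def of_bool_conj)
qed

text \<open>\<open>frob p P\<close> itself need not lie in M, but modulo p it agrees with a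
  convolution power, which does.\<close>

lemma meas_frob:
  assumes "meas P" "prime p"
  shows "meas (\<lambda>x. \<not> p dvd frob p P x)"
proof -
  have "p dvd frob p P x \<longleftrightarrow> p dvd conv_pow n (\<lambda>x. of_bool (P x)) (nat p) x" for x
    using conv_pow_frob[OF assms, of x] by (metis dvd_add_right_iff diff_add_cancel)
  then show ?thesis
    using meas_fun[OF conv_pow_closed[OF assms(1)[unfolded meas_def]], of "\<lambda>v. \<not> p dvd v" "nat p"] by simp
qed

lemma frob_nonzeroD:
  assumes "\<not> p dvd frob p P x"
  shows "\<exists>i. P i \<and> n dvd x - p * i"
proof (rule ccontr)
  assume "\<nexists>i. P i \<and> n dvd x - p * i"
  then have "frob p P x = 0" unfolding frob_def by (intro sum.neutral) auto
  then show False using assms by simp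
qed

text \<open>The residues i with p * i = x form the coset of y modulo n / p, which has p elements.
  Hence \<open>frob\<close> is nonzero modulo p as soon as P meets this coset without containing
  it.\<close>

lemma frob_bounds:
  assumes P: "meas P" and p: "prime p" "p dvd n" and y: "n dvd x - p * y"
  shows "P y \<Longrightarrow> frob p P x > 0" "\<not> P y \<Longrightarrow> frob p P x < p"
    "(\<And>i. n div p dvd i - y \<Longrightarrow> P i) \<Longrightarrow> frob p P x = p"
proof -
  define e where "e = n div p"
  have p0: "p > 0" using p(1) by (rule prime_gt_0_int)
  have e: "n = p * e" "e > 0" using p(2) n_pos p0 by (auto simp: e_def zero_less_mult_iff pos_imp_zdiv_pos_iff zdvd_imp_le)
  have coset: "n dvd x - p * i \<longleftrightarrow> e dvd i - y" for i
  proof -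
    have "x - p * i = - (p * (i - y)) + (x - p * y)" by (simp add: algebra_simps)
    then have "n dvd x - p * i \<longleftrightarrow> n dvd - (p * (i - y))"
      using dvd_add_left_iff[OF y] by metis
    then show ?thesis using p0 unfolding e(1) by simp
  qed
  have total: "(\<Sum>i\<in>{0..<n}. of_bool (e dvd i - y)) = p"
    using card_residue_class[of e n y] e p0 by simp
  have ymod: "e dvd y mod n - y" "y mod n \<in> {0..<n}"
    using n_pos e(1) by (auto simp: mod_eq_dvd_iff[symmetric] mod_mod_cancel)
  have fr: "frob p P x = (\<Sum>i\<in>{0..<n}. of_bool (P i \<and> e dvd i - y))"
    by (simp add: frob_def coset)
  show "frob p P x > 0" if "P y"
    unfolding fr by (rule sum_pos2[OF _ ymod(2)]) (use ymod(1) that meas_mod[OF P] in auto)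
  have "(\<Sum>i\<in>{0..<n}. of_bool (P i \<and> e dvd i - y)) < (\<Sum>i\<in>{0..<n}. of_bool (e dvd i - y) :: int)"
    if "\<not> P y"
  proof (rule sum_strict_mono_ex1)
    show "\<exists>i\<in>{0..<n}. of_bool (P i \<and> e dvd i - y) < (of_bool (e dvd i - y) :: int)"
      using ymod that meas_mod[OF P] by (intro bexI[of _ "y mod n"]) auto
  qed auto
  then show "frob p P x < p" if "\<not> P y" using that fr total by simp
  have "(\<Sum>i\<in>{0..<n}. of_bool (P i \<and> e dvd i - y)) = (\<Sum>i\<in>{0..<n}. of_bool (e dvd i - y) :: int)"
    if "\<And>i. n div p dvd i - y \<Longrightarrow> P i"
    by (rule sum.cong) (use that in \<open>auto simp: e_def\<close>)
  then show "frob p P x = p" if "\<And>i. n div p dvd i - y \<Longrightarrow> P i" using that fr total by simp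
qed

end

locale rational_family = schur_family +
  assumes gcd_invariant: "f \<in> M \<Longrightarrow> gcd x n = gcd y n \<Longrightarrow> f x = f y"
begin

lemma meas_gcd: "meas P \<Longrightarrow> gcd x n = gcd y n \<Longrightarrow> P x \<longleftrightarrow> P y"
  using gcd_invariant[of "\<lambda>x. of_bool (P x)" x y] by (auto simp: meas_def)

section \<open>Stabilizers, generated subgroups, quotients and subgroups of rational
  families\<close>

lemma meas_uminus: "meas P \<Longrightarrow> P (- x) \<longleftrightarrow> P x"
  by (rule meas_gcd) simp_all

text \<open>As P is symmetric, g stabilizes P iff g - x lies in P for all x in P. The convolution of
  the indicator with itself counts these x, so the stabilizer is the level set where it attains its
  maximal value, the size N of P.\<close>

lemma stabilizer:
  assumes P: "meas P"
  obtains k where "k > 0" "k dvd n" "meas ((dvd) k)"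
    "\<And>g. k dvd g \<longleftrightarrow> (\<forall>x. P x \<longrightarrow> P (x + g))"
proof -
  define D where "D = {g. \<forall>x. P x \<longrightarrow> P (x + g)}"
  have per: "y \<in> D" if "x \<in> D" "x mod n = y mod n" for x y
  proof -
    have "P (z + x) \<longleftrightarrow> P (z + y)" for z
      by (rule periodicD[OF meas_periodic[OF P]]) (rule mod_add_cong[OF refl that(2)])
    then show ?thesis using that(1) unfolding D_def mem_Collect_eq by blast
  qed
  have "\<exists>k>0. k dvd n \<and> (\<forall>x. x \<in> D \<longleftrightarrow> k dvd x)"
  proof (rule periodic_additive_set[OF n_pos])
    show "y \<in> D" if "x \<in> D" "x mod n = y mod n" for x y using per that .
  qed (auto simp: D_def simp flip: add.assoc)
  then obtain k where k: "k > 0" "k dvd n" "\<And>x. x \<in> D \<longleftrightarrow> k dvd x" by blast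
  let ?f = "\<lambda>x. of_bool (P x) :: int"
  define N where "N = (\<Sum>i\<in>{0..<n}. ?f i)"
  have "g \<in> D \<longleftrightarrow> conv n ?f ?f g = N" for g
  proof -
    have "g \<in> D \<longleftrightarrow> (\<forall>x. P x \<longrightarrow> P (g - x))"
      unfolding D_def mem_Collect_eq
      by (metis meas_uminus[OF P] minus_minus minus_diff_eq diff_conv_add_uminus add.commute)
    also have "\<dots> \<longleftrightarrow> (\<forall>x\<in>{0..<n}. P x \<longrightarrow> P (g - x))"
    proof
      assume *: "\<forall>x\<in>{0..<n}. P x \<longrightarrow> P (g - x)"
      show "\<forall>x. P x \<longrightarrow> P (g - x)"
      proof (intro allI impI)
        fix x assume "P x"
        then have "P (g - x mod n)" using * n_pos meas_mod[OF P] by auto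
        then show "P (g - x)"
          using periodicD[OF meas_periodic[OF P], of "g - x mod n" "g - x"] by (simp add: mod_diff_right_eq)
      qed
    qed blast
    also have "\<dots> \<longleftrightarrow> (\<forall>x\<in>{0..<n}. ?f x - ?f x * ?f (g - x) = 0)"
      by (intro ball_cong refl) auto
    also have "\<dots> \<longleftrightarrow> (\<Sum>x\<in>{0..<n}. ?f x - ?f x * ?f (g - x)) = 0"
      by (rule sum_nonneg_eq_0_iff[symmetric]) auto
    also have "\<dots> \<longleftrightarrow> conv n ?f ?f g = N"
      unfolding sum_subtractf N_def conv_def by linarith
    finally show ?thesis .
  qed
  then have "(dvd) k = (\<lambda>g. conv n ?f ?f g = N)" using k(3) by auto
  then have "meas ((dvd) k)"
    using meas_fun[OF conv[OF P[unfolded meas_def] P[unfolded meas_def]], of "\<lambda>v. v = N"] by simp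
  then show thesis using that k by (auto simp: D_def)
qed

text \<open>
  The subgroup generated by \<open>P\<close> arises as the stabilizer of a largest measurable set that contains 0
  and lies inside that subgroup.
\<close>

lemma generated_subgroup:
  assumes P: "meas P"
  obtains k where "k > 0" "k dvd n" "meas ((dvd) k)" "\<And>x. P x \<Longrightarrow> k dvd x"
    "\<And>d. d dvd n \<Longrightarrow> (\<And>x. P x \<Longrightarrow> d dvd x) \<Longrightarrow> d dvd k"
proof -
  define good where "good B \<longleftrightarrow> meas B \<and> B 0 \<and>
    (\<forall>d. d dvd n \<longrightarrow> (\<forall>x. P x \<longrightarrow> d dvd x) \<longrightarrow> (\<forall>x. B x \<longrightarrow> d dvd x))" for B
  let ?size = "\<lambda>B. card {i \<in> {0..<n}. B i}"
  have good_n: "good ((dvd) n)" using meas_dvd_n by (auto simp: good_def intro: dvd_trans)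
  have "\<exists>B. good B \<and> (\<forall>C. good C \<longrightarrow> ?size C \<le> ?size B)"
  proof (rule ex_has_greatest_nat[of good _ ?size "Suc (card {0..<n})"])
    show "good ((dvd) n)" by (rule good_n)
    show "\<forall>C. good C \<longrightarrow> ?size C < Suc (card {0..<n})"
      unfolding less_Suc_eq_le by (intro allI impI card_mono) auto
  qed
  then obtain B where B: "good B" "\<And>C. good C \<Longrightarrow> ?size C \<le> ?size B" by blast
  have mB: "meas B" and B0: "B 0" using B(1) by (auto simp: good_def)
  \<comment> \<open>This is B + P together with B itself. It stays inside the subgroup generated by
    P, so maximality forces C = B, and P stabilizes B. Conversely the stabilizer of B lies in B
    because B contains 0.\<close>
  define C where "C = (\<lambda>z. \<exists>x. B x \<and> (P (z - x) \<or> n dvd z - x))"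
  have mC: "meas C"
    unfolding C_def by (intro meas_sum[OF mB] meas_binop[OF P meas_dvd_n, of "(\<or>)"])
  have BC: "C z" if "B z" for z unfolding C_def using that by (intro exI[of _ z]) simp
  have "good C"
    unfolding good_def
  proof (intro conjI allI impI)
    fix d z assume d: "d dvd n" "\<forall>x. P x \<longrightarrow> d dvd x" and "C z"
    then obtain x where x: "B x" "P (z - x) \<or> n dvd z - x" by (auto simp: C_def)
    have "d dvd x" using B(1) d x(1) by (auto simp: good_def)
    moreover have "d dvd z - x" using x(2) d by (auto intro: dvd_trans)
    ultimately show "d dvd z" by (metis dvd_add diff_add_cancel)
  qed (use mC BC B0 in auto)
  then have "?size C \<le> ?size B" by (rule B(2))
  moreover have "{i \<in> {0..<n}. B i} \<subseteq> {i \<in> {0..<n}. C i}" using BC by auto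
  ultimately have "{i \<in> {0..<n}. B i} = {i \<in> {0..<n}. C i}"
    by (intro card_seteq finite_subset[OF _ finite_atLeastLessThan_int[of 0 n]]) auto
  then have "i \<in> {i \<in> {0..<n}. B i} \<longleftrightarrow> i \<in> {i \<in> {0..<n}. C i}" for i by simp
  then have "C (z mod n) \<Longrightarrow> B (z mod n)" for z
    using n_pos pos_mod_sign[of n z] pos_mod_bound[of n z] by (metis (no_types, lifting) atLeastLessThan_iff mem_Collect_eq)
  then have CB: "C z \<Longrightarrow> B z" for z using meas_mod[OF mB] meas_mod[OF mC] by blast
  obtain k where k: "k > 0" "k dvd n" "meas ((dvd) k)"
    "\<And>g. k dvd g \<longleftrightarrow> (\<forall>x. B x \<longrightarrow> B (x + g))"
    using stabilizer[OF mB] by blast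
  show thesis
  proof (rule that[OF k(1-3)])
    show "k dvd x" if "P x" for x
      unfolding k(4)
    proof (intro allI impI CB)
      fix b assume "B b"
      then show "C (b + x)" unfolding C_def using that by (intro exI[of _ b]) simp
    qed
    show "d dvd k" if "d dvd n" "\<And>x. P x \<Longrightarrow> d dvd x" for d
    proof -
      have "B k" using k(4)[of k] B0 by auto
      then show ?thesis using B(1) that by (auto simp: good_def)
    qed
  qed
qed

text \<open>For m-periodic functions convolution modulo n is n / m times convolution modulo m, and
  this factor is divided out pointwise.\<close>

lemma rational_family_quotient:
  assumes m: "m dvd n" "m > 0" "meas ((dvd) m)"
  shows "rational_family m {f \<in> M. periodic m f}"
proof unfold_locales
  show "m > 0" by fact
next
  fix f g :: "int \<Rightarrow> int" and F :: "int \<Rightarrow> int \<Rightarrow> int"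
  assume "f \<in> {f \<in> M. periodic m f}" "g \<in> {f \<in> M. periodic m f}"
  then have f: "f \<in> M" "periodic m f" and g: "g \<in> M" "periodic m g" by auto
  have "periodic m (\<lambda>x. F (f x) (g x))"
  proof (rule periodicI)
    fix x y assume "x mod m = y mod m"
    then show "F (f x) (g x) = F (f y) (g y)" using f(2) g(2) by (metis periodicD)
  qed
  then show "(\<lambda>x. F (f x) (g x)) \<in> {f \<in> M. periodic m f}"
    using pointwise2[OF f(1) g(1)] by simp
  have p: "periodic m (\<lambda>i. f i * g (x - i))" for x
    by (rule periodic_conv_summand[OF f(2) g(2)])
  have q: "n div m > 0" using m n_pos by (simp add: pos_imp_zdiv_pos_iff zdvd_imp_le)
  have "conv n f g x = n div m * conv m f g x" for x
    unfolding conv_def using sum_periodic_multiple[OF m(2) p m(1)] n_pos by simp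
  then have "conv m f g = (\<lambda>x. conv n f g x div (n div m))" using q by (simp add: fun_eq_iff)
  moreover have "(\<lambda>x. conv n f g x div (n div m)) \<in> M"
    by (intro pointwise[OF conv] f g)
  moreover have "periodic m (conv m f g)"
  proof (rule periodicI)
    fix x y assume xy: "x mod m = y mod m"
    have "g (x - i) = g (y - i)" for i
      by (rule periodicD[OF g(2)]) (rule mod_diff_cong[OF xy refl])
    then show "conv m f g x = conv m f g y" by (simp add: conv_def)
  qed
  ultimately show "conv m f g \<in> {f \<in> M. periodic m f}" by simp
next
  fix f assume "f \<in> {f \<in> M. periodic m f}"
  then have f: "f \<in> M" "periodic m f" by auto
  then show "periodic m f" by simp
  fix x y :: int assume xy: "gcd x m = gcd y m"
  obtain x' where x': "x' mod m = x mod m" "gcd x' n = gcd x m"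
    using gcd_lift[OF m(1) n_pos] by blast
  obtain y' where y': "y' mod m = y mod m" "gcd y' n = gcd y m"
    using gcd_lift[OF m(1) n_pos] by blast
  have "f x' = f y'" by (rule gcd_invariant) (use f xy x' y' in auto)
  then show "f x = f y" using periodicD[OF f(2) x'(1)] periodicD[OF f(2) y'(1)] by simp
next
  have "periodic m (\<lambda>x. of_bool (m dvd x) :: int)"
    by (rule periodicI) (simp add: dvd_eq_mod_eq_0)
  then show "(\<lambda>x. of_bool (m dvd x)) \<in> {f \<in> M. periodic m f}"
    using m(3) by (simp add: meas_def)
qed

text \<open>Multiplication by h identifies the integers modulo n / h with the subgroup of multiples
  of h modulo n.\<close>

lemma rational_family_subgroup:
  assumes h: "h dvd n" "h > 0" "meas ((dvd) h)"
  shows "rational_family (n div h) ((\<lambda>f x. f (h * x)) ` M)"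
proof unfold_locales
  define e where "e = n div h"
  have e: "n = h * e" "e > 0" using h n_pos by (auto simp: e_def pos_imp_zdiv_pos_iff zdvd_imp_le)
  show "n div h > 0" using e by (simp add: e_def)
  {
    fix f assume f: "f \<in> (\<lambda>f x. f (h * x)) ` M"
    then obtain f' where f': "f' \<in> M" "f = (\<lambda>x. f' (h * x))" by blast
    show "periodic (n div h) f"
      unfolding f' e_def[symmetric]
    proof (rule periodicI)
      fix x y assume "x mod e = y mod e"
      then have "h * x mod n = h * y mod n"
        unfolding e(1) by (simp only: mult_mod_right[symmetric])
      then show "f' (h * x) = f' (h * y)" by (rule periodicD[OF periodic[OF f'(1)]])
    qed
    show "f x = f y" if "gcd x (n div h) = gcd y (n div h)" for x y
    proof -
      have "gcd (h * x) n = gcd (h * y) n"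
        using that h(2) unfolding e_def[symmetric] by (simp add: e(1) gcd_mult_distrib_int[symmetric])
      then show ?thesis unfolding f' by (rule gcd_invariant[OF f'(1)])
    qed
    fix g assume g: "g \<in> (\<lambda>f x. f (h * x)) ` M"
    then obtain g' where g': "g' \<in> M" "g = (\<lambda>x. g' (h * x))" by blast
    show "(\<lambda>x. F (f x) (g x)) \<in> (\<lambda>f x. f (h * x)) ` M" for F :: "int \<Rightarrow> int \<Rightarrow> int"
      unfolding f' g' by (rule image_eqI[OF _ pointwise2[OF f'(1) g'(1), of F]]) simp
    \<comment> \<open>Cutting \<open>f'\<close> off outside the multiples of h confines the
      convolution modulo n to the subgroup.\<close>
    define k where "k = (\<lambda>x. of_bool (h dvd x) * f' x)"
    have k: "k \<in> M"
      unfolding k_def using pointwise2[OF h(3)[unfolded meas_def] f'(1), of "(*)"] by simp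
    have "conv n k g' (h * x) = conv e f g x" for x
    proof -
      have "conv n k g' (h * x) = (\<Sum>i\<in>{0..<n}. k i * g' (h * x - i))" by (simp add: conv_def)
      also have "\<dots> = (\<Sum>i\<in>(\<lambda>i. h * i) ` {0..<e}. k i * g' (h * x - i))"
      proof (rule sum.mono_neutral_right)
        show "(\<lambda>i. h * i) ` {0..<e} \<subseteq> {0..<n}" using h(2) e by auto
        show "\<forall>i\<in>{0..<n} - (\<lambda>i. h * i) ` {0..<e}. k i * g' (h * x - i) = 0"
        proof
          fix i assume i: "i \<in> {0..<n} - (\<lambda>i. h * i) ` {0..<e}"
          have "\<not> h dvd i"
          proof
            assume "h dvd i"
            then obtain j where "i = h * j" by blast
            moreover from this have "j \<in> {0..<e}"
              using i h(2) e(1) by (auto simp: zero_le_mult_iff)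
            ultimately show False using i by auto
          qed
          then show "k i * g' (h * x - i) = 0" by (simp add: k_def)
        qed
      qed simp
      also have "\<dots> = conv e f g x"
        using h(2) by (subst sum.reindex)
          (auto simp: inj_on_def conv_def k_def f' g' right_diff_distrib)
      finally show ?thesis .
    qed
    then show "conv (n div h) f g \<in> (\<lambda>f x. f (h * x)) ` M"
      unfolding e_def[symmetric] by (intro image_eqI[OF _ conv[OF k g'(1)]]) auto
  }
  show "(\<lambda>x. of_bool (n div h dvd x)) \<in> (\<lambda>f x. f (h * x)) ` M"
    by (rule image_eqI[OF _ identity]) (use e h(2) in \<open>simp add: fun_eq_iff e_def[symmetric]\<close>)
qed

end

section \<open>Basic sets of rational S-rings contain generators\<close>

lemma prime_power_decomposition:
  fixes n p :: int
  assumes "n > 0" "prime p" "p dvd n"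
  obtains a r where "n = p ^ Suc a * r" "\<not> p dvd r"
proof -
  have "n \<noteq> 0" "\<not> is_unit p" using assms by (auto simp: not_prime_unit)
  then obtain r where r: "n = p ^ multiplicity p n * r" "\<not> p dvd r"
    using multiplicity_decompose' by blast
  have "multiplicity p n \<noteq> 0" using r assms(3) by (metis mult_1 power_0)
  then obtain a where "multiplicity p n = Suc a" using not0_implies_Suc by blast
  then show thesis using that r by metis
qed

text \<open>If p ^ a divides n but not x, then p divides n / gcd x n, so gcd x n divides n / p and
  with it every y congruent to x modulo n / p. In a rational family, elements differing by a
  multiple of n / p thus lie in the same S-sets unless one of them is divisible by p ^ a.\<close>

lemma gcd_eq_if_cong_prime_cofactor:
  fixes n p :: int
  assumes n: "n > 0" and p: "prime p" "p dvd n" and N: "p ^ a dvd n"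
    and zz: "n div p dvd z - z'" and z: "\<not> p ^ a dvd z" "\<not> p ^ a dvd z'"
  shows "gcd z n = gcd z' n"
proof -
  have *: "gcd x n dvd gcd y n" if x: "\<not> p ^ a dvd x" and xy: "n div p dvd x - y" for x y
  proof -
    obtain c where c: "n = gcd x n * c" by (meson dvdE gcd_dvd2)
    have "p dvd c"
    proof (rule ccontr)
      assume "\<not> p dvd c"
      then have "coprime (p ^ a) c" using p(1) by (simp add: prime_imp_coprime)
      moreover have "p ^ a dvd gcd x n * c" using N c by simp
      ultimately have "p ^ a dvd gcd x n" by (simp add: coprime_dvd_mult_left_iff)
      then show False using x by simp
    qed
    then obtain c' where "c = p * c'" by blast
    then have "n = p * (gcd x n * c')" using c by (metis mult.left_commute)
    then have "n div p = gcd x n * c'" using p(1) by (metis nonzero_mult_div_cancel_left not_prime_0)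
    then have "gcd x n dvd x - y" using xy by (metis dvd_mult_left dvd_trans dvd_triv_left)
    then have "gcd x n dvd x - (x - y)" by (rule dvd_diff[OF gcd_dvd1])
    then show ?thesis by simp
  qed
  have "n div p dvd z' - z" using zz by (simp add: dvd_diff_commute)
  then show ?thesis
    by (intro zdvd_antisym_nonneg gcd_ge_0_int *[OF z(1) zz] *[OF z(2)])
qed

context rational_family
begin

text \<open>If x is not divisible by the full power of p in n, the fibre of multiplication by p over
  x lies in one gcd class or is empty. P then contains all p points of it or none, and
  \<open>frob\<close> vanishes modulo p.\<close>

lemma frobenius_subgroup:
  assumes P: "meas P" and p: "prime p" "p dvd n"
  obtains l where "l > 0" "l dvd n" "meas ((dvd) l)" "p dvd l" "\<not> p dvd n div l"
    "\<And>x. \<not> p dvd frob p P x \<Longrightarrow> l dvd x"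
proof -
  obtain a r where ar: "n = p ^ Suc a * r" "\<not> p dvd r"
    using prime_power_decomposition[OF n_pos p] by blast
  have p0: "p > 0" using p(1) by (rule prime_gt_0_int)
  have e: "n div p = p ^ a * r" using ar(1) p0 by simp
  obtain l where l: "l > 0" "l dvd n" "meas ((dvd) l)" "\<And>x. \<not> p dvd frob p P x \<Longrightarrow> l dvd x"
    and l_greatest: "\<And>d. d dvd n \<Longrightarrow> (\<And>x. \<not> p dvd frob p P x \<Longrightarrow> d dvd x) \<Longrightarrow> d dvd l"
    using generated_subgroup[OF meas_frob[OF P p(1)]] by metis
  have "p ^ Suc a dvd x" if x: "\<not> p dvd frob p P x" for x
  proof (rule ccontr)
    assume nd: "\<not> p ^ Suc a dvd x"
    obtain i where i: "P i" "n dvd x - p * i" using frob_nonzeroD[OF x] by blast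
    have ni: "\<not> p ^ a dvd i"
    proof
      assume "p ^ a dvd i"
      then have "p ^ Suc a dvd p * i" by simp
      moreover have "p ^ Suc a dvd x - p * i" using i(2) ar(1) by (metis dvd_mult_left)
      ultimately have "p ^ Suc a dvd (x - p * i) + p * i" by (intro dvd_add)
      then show False using nd by simp
    qed
    have "P j" if j: "n div p dvd j - i" for j
    proof -
      have nj: "\<not> p ^ a dvd j"
      proof
        assume "p ^ a dvd j"
        moreover have "p ^ a dvd j - i" using j e by (metis dvd_mult_left)
        ultimately have "p ^ a dvd j - (j - i)" by (rule dvd_diff)
        then show False using ni by simp
      qed
      have "\<not> p ^ Suc a dvd j" "\<not> p ^ Suc a dvd i" using nj ni by (auto dest: dvd_mult_right)
      then have "gcd j n = gcd i n"
        by (intro gcd_eq_if_cong_prime_cofactor[where a = "Suc a", OF n_pos p _ j]) (use ar in auto)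
      then show "P j" using meas_gcd[OF P] i(1) by blast
    qed
    then have "frob p P x = p" by (rule frob_bounds(3)[OF P p i(2)])
    then show False using x by simp
  qed
  then have pl: "p ^ Suc a dvd l" by (intro l_greatest) (use ar in auto)
  have "\<not> p dvd n div l"
  proof
    assume "p dvd n div l"
    then have "p ^ Suc a * p dvd l * (n div l)" using pl by (intro mult_dvd_mono)
    then have "p ^ Suc a * p dvd p ^ Suc a * r" using l(2) ar(1) by simp
    then show False using ar(2) p0 by (simp only: dvd_mult_cancel_left) simp
  qed
  moreover have "p dvd l" using pl by (auto dest: dvd_mult_left)
  ultimately show thesis using that l by blast
qed


text \<open>An S-subgroup of an S-subgroup is an S-subgroup. The values of g outside the multiples
  of h are unknown and are erased by the indicator.\<close>

lemma meas_dvd_of_subgroup: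
  assumes "(\<lambda>x. of_bool (k dvd x)) \<in> (\<lambda>f x. f (h * x)) ` M" "meas ((dvd) h)" "h \<noteq> 0"
  shows "meas ((dvd) (h * k))"
proof -
  obtain g where g: "g \<in> M" "\<And>x. of_bool (k dvd x) = g (h * x)"
    using assms(1) by (auto simp: fun_eq_iff)
  have "(\<lambda>x. of_bool (h dvd x) * g x) \<in> M"
    by (rule pointwise2[OF assms(2)[unfolded meas_def] g(1)])
  moreover have "of_bool (h dvd x) * g x = of_bool (h * k dvd x)" for x
  proof (cases "h dvd x")
    case True
    then obtain c where "x = h * c" by blast
    then show ?thesis using g(2)[of c] assms(3) by (simp flip: g(2))
  qed (auto dest: dvd_mult_left)
  ultimately show ?thesis by (simp add: meas_def)
qed

text \<open>
  Let \<open>U\<close> and \<open>V\<close> be the basic sets of 1 and \<open>t\<close>, assumed distinct. Passing to quotients gives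
  \<open>t \<in> U + m\<int>\<close> for every proper subgroup in the family. For a prime \<open>p\<close> dividing \<open>n\<close>, let \<open>l\<int>\<close> be the
  subgroup generated by the \<open>p\<close>-th power set of \<open>U\<close>; its order is prime to \<open>p\<close>, and the stabilizer of
  \<open>(U + l\<int>) \<union> l\<int>\<close> is everything, so that \<open>U + l\<int>\<close> is the complement of \<open>l\<int>\<close> and \<open>l\<int>\<close> is a
  maximal subgroup of the family. By induction inside \<open>l\<int>\<close>, the \<open>p\<close>-th power sets of both \<open>U\<close> and
  \<open>V\<close> contain \<open>l\<close>, which forces \<open>U\<close> and \<open>V\<close> to meet.
\<close>

lemma cell_of_generator_step:
  assumes IH: "\<And>m N s f. 0 < m \<Longrightarrow> m < n \<Longrightarrow> rational_family m N \<Longrightarrow>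
      (\<And>h. 1 < h \<Longrightarrow> h dvd m \<Longrightarrow> h dvd s \<Longrightarrow> (\<lambda>x. of_bool (h dvd x)) \<notin> N) \<Longrightarrow> f \<in> N \<Longrightarrow> f s = f 1"
    and t: "\<And>h. 1 < h \<Longrightarrow> h dvd n \<Longrightarrow> h dvd t \<Longrightarrow> \<not> meas ((dvd) h)"
    and f0: "f0 \<in> M"
  shows "f0 t = f0 1"
proof (rule ccontr)
  assume ne: "f0 t \<noteq> f0 1"
  define U where "U = cell 1"
  define V where "V = cell t"
  have mU: "meas U" and mV: "meas V" by (simp_all add: U_def V_def meas_cell)
  have U1: "U 1" and Vt: "V t" by (simp_all add: U_def V_def cell_refl)
  have disj: "\<not> V y" if "U y" for y
    using that ne f0 unfolding U_def V_def cell_def by metis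
  have U_meas: "P y" if "meas P" "U x" "P x" "U y" for P x y
    using that cell_meas[of 1] unfolding U_def by blast
  have V_meas: "P y" if "meas P" "V x" "P x" "V y" for P x y
    using that cell_meas[of t] unfolding V_def by blast
  have n1: "n > 1"
  proof (rule ccontr)
    assume "\<not> n > 1"
    then have "n = 1" using n_pos by simp
    then have "f0 t = f0 1" by (intro gcd_invariant[OF f0]) simp
    then show False using ne by simp
  qed
  have nt: "\<not> n dvd t" using t[OF n1] meas_dvd_n by auto
  have U_sub: "\<not> m dvd x" if "meas ((dvd) m)" "1 < m" "U x" for m x
    using U_meas[OF that(1,3) _ U1] that(2) by auto
  have V_sub: "\<not> m dvd x" if "meas ((dvd) m)" "1 < m" "m dvd n" "V x" for m x
    using V_meas[OF that(1,4) _ Vt] t that(1-3) by blast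
  define Q where "Q m z \<longleftrightarrow> (\<exists>x. U x \<and> m dvd z - x)" for m z
  have mQ: "meas (Q m)" if "meas ((dvd) m)" for m
    unfolding Q_def by (rule meas_sum[OF mU that])
  have Q_quot: "(\<lambda>x. of_bool (Q m x)) \<in> {f \<in> M. periodic m f}" if "meas ((dvd) m)" for m
  proof -
    have "periodic m (\<lambda>x. of_bool (Q m x) :: int)"
    proof (rule periodicI)
      fix x y assume "x mod m = y mod m"
      then have "(x - z) mod m = (y - z) mod m" for z by (rule mod_diff_cong) simp
      then show "(of_bool (Q m x) :: int) = of_bool (Q m y)"
        by (simp add: Q_def dvd_eq_mod_eq_0)
    qed
    then show ?thesis using mQ[OF that] by (simp add: meas_def)
  qed
  have Q1: "Q m x" if "U x" for m x unfolding Q_def using that by (intro exI[of _ x]) simp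
  have Qt: "Q m t" if m: "0 < m" "m dvd n" "m < n" "meas ((dvd) m)" for m
  proof -
    have "(of_bool (Q m t) :: int) = of_bool (Q m 1)"
    proof (rule IH[OF m(1,3) rational_family_quotient[OF m(2,1,4)] _ Q_quot[OF m(4)]])
      fix h assume "1 < h" "h dvd m" "h dvd t"
      then show "(\<lambda>x. of_bool (h dvd x)) \<notin> {f \<in> M. periodic m f}"
        using t[of h] m(2) by (auto simp: meas_def intro: dvd_trans)
    qed
    then show ?thesis using Q1[OF U1, of m] by simp
  qed
  \<comment> \<open>Such l is produced for every prime divisor of n, because the appeal to the
    induction hypothesis below compares l with the subgroup belonging to a second prime q.\<close>
  define good where "good p l \<longleftrightarrow> l dvd n \<and> 1 < l \<and> l < n \<and> p dvd l \<and> \<not> p dvd n div l \<and>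
    meas ((dvd) l) \<and> (\<forall>z. l dvd z \<or> Q l z)" for p l
  have ex_good: "\<exists>l. good p l" if p: "prime p" "p dvd n" for p
  proof -
    define e where "e = n div p"
    have p1: "p > 1" using p(1) by (rule prime_gt_1_int)
    have e: "n = p * e" using p(2) by (simp add: e_def)
    have e0: "e > 0" "e < n" using e n_pos p1 by (auto simp: zero_less_mult_iff)
    obtain l where l: "l > 0" "l dvd n" "meas ((dvd) l)" "p dvd l" "\<not> p dvd n div l"
      and l_frob: "\<And>x. \<not> p dvd frob p U x \<Longrightarrow> l dvd x"
      using frobenius_subgroup[OF mU p] by metis
    obtain l' where l': "l = p * l'" using l(4) by blast
    have l1: "l > 1" using zdvd_imp_le[OF l(4,1)] p1 by simp
    have l'e: "l' dvd e"
    proof -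
      obtain c where "n = l * c" using l(2) by blast
      then have "e = l' * c" using e l' p1 by simp
      then show ?thesis by simp
    qed
    have le: "\<not> l dvd e"
    proof
      assume "l dvd e"
      then obtain c where "e = l * c" by blast
      then have "n = l * (p * c)" using e by simp
      then have "n div l = p * c" using l1 by simp
      then show False using l(5) by simp
    qed
    \<comment> \<open>Where translation by e leaves U, the fibre over p * x is met but not filled by
      U, so p * x lies in the subgroup generated by the p-th power set.\<close>
    have bad: "l' dvd x" if x: "U x" "\<not> U (x + e)" for x
    proof -
      have "n dvd p * x - p * (x + e)" using e by (simp add: algebra_simps)
      then have "frob p U (p * x) < p" using x(2) by (intro frob_bounds(2)[OF mU p])
      moreover have "frob p U (p * x) > 0" using x(1) by (intro frob_bounds(1)[OF mU p, of _ x]) simp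
      ultimately have "\<not> p dvd frob p U (p * x)" using zdvd_not_zless by blast
      then have "l dvd p * x" by (rule l_frob)
      then show ?thesis using l' p1 by simp
    qed
    \<comment> \<open>If U were invariant under e, its stabilizer would be a nontrivial subgroup kZ,
      and U = U + kZ would contain t by \<open>Qt\<close>.\<close>
    have "\<exists>x0. U x0 \<and> \<not> U (x0 + e)"
    proof (rule ccontr)
      assume "\<nexists>x0. U x0 \<and> \<not> U (x0 + e)"
      then have stable: "U (x + e)" if "U x" for x using that by blast
      obtain k where k: "k > 0" "k dvd n" "meas ((dvd) k)"
        "\<And>g. k dvd g \<longleftrightarrow> (\<forall>x. U x \<longrightarrow> U (x + g))"
        using stabilizer[OF mU] by blast
      have "k dvd e" using k(4) stable by blast
      then have "k < n" using zdvd_imp_le[of k e] e0 by simp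
      then obtain x where x: "U x" "k dvd t - x" using Qt[OF k(1,2) _ k(3)] by (auto simp: Q_def)
      then have "U (x + (t - x))" using k(4) by blast
      then show False using disj Vt by auto
    qed
    then obtain x0 where x0: "U x0" "\<not> U (x0 + e)" by blast
    define Y where "Y z \<longleftrightarrow> Q l z \<or> l dvd z" for z
    have mY: "meas Y"
      unfolding Y_def by (intro meas_binop[OF mQ[OF l(3)] l(3), of "(\<or>)"])
    \<comment> \<open>The multiples of l' outside lZ all have gcd l' with l. By \<open>bad\<close>
      the point x0 is one of them, it lies in \<open>Q l\<close>, and \<open>Q l\<close> is
      invariant under units modulo l.\<close>
    have Yl': "Y z" if z: "l' dvd z" for z
    proof (cases "l dvd z")
      case False
      have gcd_l: "gcd z l = \<bar>l'\<bar>" if z: "l' dvd z" "\<not> l dvd z" for z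
      proof -
        obtain w where w: "z = l' * w" using z(1) by blast
        then have "\<not> p dvd w" using z(2) l' by (auto simp: mult.commute)
        then have "gcd w p = 1" using p(1) by (metis coprime_imp_gcd_eq_1 prime_imp_coprime gcd.commute)
        then show ?thesis unfolding w l' by (simp add: mult.commute[of p] gcd_mult_left)
      qed
      have "gcd z l = gcd x0 l"
        using gcd_l[OF z False] gcd_l[OF bad[OF x0] U_sub[OF l(3) l1 x0(1)]] by simp
      then have "(of_bool (Q l z) :: int) = of_bool (Q l x0)"
        by (rule rational_family.gcd_invariant[OF rational_family_quotient[OF l(2,1,3)] Q_quot[OF l(3)]])
      then show ?thesis using Q1[OF x0(1), of l] by (simp add: Y_def)
    qed (simp add: Y_def)
    \<comment> \<open>Multiples of l' stay multiples of l'; any other point of Y comes from an x in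
      U that is no multiple of l', and \<open>bad\<close> keeps x + e in U.\<close>
    have Ye: "Y (y + e)" if y: "Y y" for y
    proof (cases "l' dvd y")
      case True
      then show ?thesis using l'e by (intro Yl') simp
    next
      case False
      then have "\<not> l dvd y" using l' by (auto dest: dvd_mult_right)
      then obtain x where x: "U x" "l dvd y - x" using y by (auto simp: Y_def Q_def)
      have "l' dvd y - x" using x(2) l' by (auto dest: dvd_mult_right)
      then have "\<not> l' dvd x" using False by (metis dvd_add_right_iff diff_add_cancel)
      then have "U (x + e)" using bad x(1) by blast
      then show ?thesis unfolding Y_def Q_def using x(2) by (intro disjI1 exI[of _ "x + e"]) simp
    qed
    obtain k where k: "k > 0" "k dvd n" "meas ((dvd) k)"
      "\<And>g. k dvd g \<longleftrightarrow> (\<forall>x. Y x \<longrightarrow> Y (x + g))"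
      using stabilizer[OF mY] by blast
    have Y0: "Y 0" by (simp add: Y_def)
    have ke: "k dvd e" using k(4) Ye by blast
    have "Y (z + l)" if "Y z" for z
      using that unfolding Y_def
    proof
      assume "Q l z"
      then obtain x where x: "U x" "l dvd z - x" by (auto simp: Q_def)
      have "l dvd z - x + l" using x(2) by simp
      also have "z - x + l = z + l - x" by simp
      finally show "Q l (z + l) \<or> l dvd z + l" using x(1) by (auto simp: Q_def)
    qed simp
    then have kl: "k dvd l" using k(4) by blast
    \<comment> \<open>The stabilizer contains e and l. Since e lies in U + lZ, k divides an element
      of U, which lies in no proper subgroup of the family.\<close>
    have "Y e" using k(4)[of e] ke Y0 by auto
    then obtain x where x: "U x" "l dvd e - x" using le by (auto simp: Y_def Q_def)
    have "k dvd e - (e - x)" by (rule dvd_diff[OF ke dvd_trans[OF kl x(2)]])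
    then have "k dvd x" by simp
    then have "\<not> 1 < k" using U_sub[OF k(3) _ x(1)] by blast
    then have "k = 1" using k(1) by simp
    then have Yall: "Y z" for z using k(4)[of z] Y0 by auto
    have "l \<noteq> n"
    proof
      assume "l = n"
      then obtain x where x: "U x" "n dvd t - x" using Yall[of t] nt by (auto simp: Y_def Q_def)
      then have "U t" using periodicD[OF meas_periodic[OF mU], of t x] by (simp add: mod_eq_dvd_iff)
      then show False using disj Vt by blast
    qed
    then have "l < n" using zdvd_imp_le[OF l(2) n_pos] by simp
    then have "good p l" using l l1 Yall by (auto simp: good_def Y_def)
    then show ?thesis by blast
  qed
  \<comment> \<open>A larger subgroup mZ has a point outside lZ, hence in U + lZ, and so it meets
    U.\<close>
  have maximal: "m = l" if gl: "good p l" and m: "1 < m" "m dvd l" "meas ((dvd) m)" for p l m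
  proof (rule ccontr)
    assume "m \<noteq> l"
    then have "\<not> l dvd m" using m gl zdvd_antisym_nonneg[of m l] by (auto simp: good_def)
    then have "Q l m" using gl by (auto simp: good_def)
    then obtain x where x: "U x" "l dvd m - x" by (auto simp: Q_def)
    then have "m dvd m - (m - x)" by (intro dvd_diff[OF dvd_refl] dvd_trans[OF m(2)])
    then show False using U_sub[OF m(3,1) x(1)] by simp
  qed
  obtain p where p: "prime p" "p dvd n" using prime_divisor_exists[of n] n1 by auto
  have p1: "p > 1" using p(1) by (rule prime_gt_1_int)
  define e where "e = n div p"
  have e: "n = p * e" using p(2) by (simp add: e_def)
  obtain l where gl: "good p l" using ex_good[OF p] by blast
  then have l: "l dvd n" "1 < l" "l < n" "p dvd l" "\<not> p dvd n div l" "meas ((dvd) l)"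
    and lQ: "\<And>z. l dvd z \<or> Q l z" by (auto simp: good_def)
  define r where "r = n div l"
  have r: "n = l * r" "\<not> p dvd r" using l by (auto simp: r_def)
  have r0: "0 < r" "r < n" using r(1) l(2) n_pos by (auto simp: zero_less_mult_iff)
  have le: "\<not> l dvd e"
  proof
    assume "l dvd e"
    then obtain c where "e = l * c" by blast
    then have "l * r = l * (p * c)" using e r(1) by simp
    then have "r = p * c" using l(2) by simp
    then show False using r(2) by simp
  qed
  \<comment> \<open>V + lZ meets U because t lies in U + lZ; hence it contains U and everything
    outside lZ.\<close>
  have lV: "\<exists>y. V y \<and> l dvd z - y" if z: "\<not> l dvd z" for z
  proof -
    define R where "R z \<longleftrightarrow> (\<exists>y. V y \<and> l dvd z - y)" for z
    have mR: "meas R" unfolding R_def by (rule meas_sum[OF mV l(6)])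
    obtain x where x: "U x" "l dvd t - x" using Qt[OF _ l(1,3,6)] l(2) by (auto simp: Q_def)
    have "R x" unfolding R_def using Vt x(2) by (auto simp: dvd_diff_commute)
    then have UR: "R y" if "U y" for y using U_meas[OF mR x(1) _ that] by blast
    obtain x' where x': "U x'" "l dvd z - x'" using lQ[of z] z by (auto simp: Q_def)
    obtain y where y: "V y" "l dvd x' - y" using UR[OF x'(1)] by (auto simp: R_def)
    have "l dvd (z - x') + (x' - y)" using x'(2) y(2) by (rule dvd_add)
    then show ?thesis using y(1) by auto
  qed
  have key: "\<exists>y. W y \<and> n dvd l - p * y"
    if W: "meas W" and W_sub: "\<And>m y. meas ((dvd) m) \<Longrightarrow> 1 < m \<Longrightarrow> m dvd n \<Longrightarrow> W y \<Longrightarrow> \<not> m dvd y"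
      and lW: "\<And>z. \<not> l dvd z \<Longrightarrow> \<exists>y. W y \<and> l dvd z - y" for W
  proof -
    \<comment> \<open>With y in e + lZ the point y - e lies in lZ, which W avoids. The fibre over p
      * y is therefore only partly filled; moreover l divides p * y because p * e = n.\<close>
    obtain y where y: "W y" "l dvd e - y" using lW[OF le] by blast
    have ny: "\<not> W (y - e)"
      using W_sub[OF l(6,2,1), of "y - e"] y(2) by (auto simp: dvd_diff_commute)
    have "n dvd p * y - p * (y - e)" using e by (simp add: algebra_simps)
    then have "frob p W (p * y) < p" using ny by (intro frob_bounds(2)[OF W p])
    moreover have "frob p W (p * y) > 0" using y(1) by (intro frob_bounds(1)[OF W p, of _ y]) simp
    ultimately have F: "\<not> p dvd frob p W (p * y)" using zdvd_not_zless by blast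
    have "p * y = n - p * (e - y)" using e by (simp add: algebra_simps)
    also have "l dvd \<dots>" by (rule dvd_diff[OF l(1) dvd_mult[OF y(2)]])
    finally obtain s where s: "p * y = l * s" by blast
    let ?N = "(\<lambda>f x. f (l * x)) ` M"
    define F where "F = (\<lambda>x. of_bool (\<not> p dvd frob p W x) :: int)"
    have FM: "F \<in> M" using meas_frob[OF W p(1)] by (simp add: F_def meas_def)
    \<comment> \<open>The induction hypothesis inside lZ, where l plays the role of 1 and p * y that
      of t.\<close>
    have "F (l * s) = F (l * 1)"
    proof (rule IH[of r ?N s "\<lambda>x. F (l * x)"])
      show "rational_family r ?N"
        unfolding r_def using l by (intro rational_family_subgroup) auto
      show "(\<lambda>x. F (l * x)) \<in> ?N" using FM by (rule imageI)
      fix h assume h: "1 < h" "h dvd r" "h dvd s"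
      show "(\<lambda>x. of_bool (h dvd x)) \<notin> ?N"
      proof
        assume "(\<lambda>x. of_bool (h dvd x)) \<in> ?N"
        from meas_dvd_of_subgroup[OF this l(6)] have mh: "meas ((dvd) (l * h))" using l(2) by simp
        \<comment> \<open>A subgroup that excludes this use of the hypothesis has index divisible by
          some q in lZ. By maximality k divides p * y: if p divides k then k = l, against q not
          dividing n / k; otherwise k divides y, which W forbids.\<close>
        obtain q where q: "prime q" "q dvd h" using prime_divisor_exists[of h] h(1) by auto
        have qn: "q dvd n" unfolding r(1) using q(2) h(2) by (auto intro: dvd_trans)
        then obtain k where gk: "good q k" using ex_good[OF q(1)] by blast
        then have k: "k dvd n" "1 < k" "q dvd k" "\<not> q dvd n div k" "meas ((dvd) k)"
          by (auto simp: good_def)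
        have gcd_gt1: "1 < gcd i j" if "prime u" "u dvd i" "u dvd j" "0 < j" for i j u :: int
        proof -
          have "u \<le> gcd i j" using that by (intro zdvd_imp_le) auto
          then show ?thesis using prime_gt_1_int[OF that(1)] by simp
        qed
        have "gcd (l * h) k = k"
          by (rule maximal[OF gk]) (use q k mh gcd_gt1[of q] in \<open>auto intro!: meas_gcd_dvd\<close>)
        then have "k dvd l * h" by (metis gcd_dvd1)
        also have "l * h dvd p * y" unfolding s using h(3) by simp
        finally have kpy: "k dvd p * y" .
        show False
        proof (cases "p dvd k")
          case True
          have g1: "1 < gcd l k" using gcd_gt1[OF p(1) l(4) True] k(2) by simp
          have "gcd l k = l" by (rule maximal[OF gl g1 gcd_dvd1 meas_gcd_dvd[OF l(6) k(5)]])
          moreover have "gcd l k = k" by (rule maximal[OF gk g1 gcd_dvd2 meas_gcd_dvd[OF l(6) k(5)]])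
          ultimately have "l = k" by (rule trans[OF sym])
          then show False using k(4) q(2) h(2) by (auto simp: r_def intro: dvd_trans)
        next
          case False
          then have "coprime k p" using p(1) by (metis prime_imp_coprime coprime_commute)
          then have "k dvd y" using kpy by (simp add: coprime_dvd_mult_right_iff)
          then show False using W_sub[OF k(5,2,1) y(1)] by simp
        qed
      qed
    qed (use r0 in auto)
    then have "\<not> p dvd frob p W l" using F by (simp add: F_def flip: s split: if_splits)
    then show ?thesis by (rule frob_nonzeroD)
  qed
  have no_l: "\<not> m dvd y" if "meas ((dvd) m)" "1 < m" "m dvd n" "U y" for m y
    by (rule U_sub[OF that(1,2,4)])
  obtain y where y: "V y" "n dvd l - p * y" using key[OF mV V_sub lV] by blast
  obtain x where x: "U x" "n dvd l - p * x"
    using key[OF mU no_l] lQ by (auto simp: Q_def)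
  obtain a c where ac: "n = p ^ Suc a * c" "\<not> p dvd c"
    using prime_power_decomposition[OF n_pos p] by blast
  \<comment> \<open>Here l divides p * z. If z carried the full power of p, l would also divide c *
    z, and hence z, as c is prime to p.\<close>
  have not_p_part: "\<not> p ^ Suc a dvd z" if z: "\<not> l dvd z" "n dvd l - p * z" for z
  proof
    assume "p ^ Suc a dvd z"
    then have "n dvd z * c" unfolding ac(1) by (intro mult_dvd_mono) auto
    then have 1: "l dvd z * c" using l(1) by (rule dvd_trans[rotated])
    have "l dvd l - (l - p * z)" by (rule dvd_diff[OF dvd_refl dvd_trans[OF l(1) z(2)]])
    then have 2: "l dvd z * p" by (simp add: mult.commute)
    have "l dvd gcd (z * c) (z * p)" using 1 2 by simp
    also have "gcd (z * c) (z * p) = \<bar>z\<bar>"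
      using ac(2) p(1) by (simp add: gcd_mult_left) (metis coprime_imp_gcd_eq_1 gcd.commute mult_1_right prime_imp_coprime)
    finally show False using z(1) by simp
  qed
  \<comment> \<open>The points x of U and y of V lie in the same fibre of multiplication by p, and
    equal gcds put x into V as well.\<close>
  have "n dvd (l - p * y) - (l - p * x)" using y(2) x(2) by (rule dvd_diff)
  then have "p * e dvd p * (x - y)" using e by (simp add: algebra_simps)
  then have "n div p dvd x - y" using p1 by (simp add: e_def)
  then have "gcd x n = gcd y n"
    using not_p_part[OF no_l[OF l(6,2,1) x(1)] x(2)] not_p_part[OF V_sub[OF l(6,2,1) y(1)] y(2)] ac(1)
    by (intro gcd_eq_if_cong_prime_cofactor[where a = "Suc a", OF n_pos p]) auto
  then show False using meas_gcd[OF mV] y(1) x(1) disj by blast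
qed

end

text \<open>The strong induction on n ranges over all families, since the step passes to quotients
  and subgroups.\<close>

theorem cell_of_generator:
  assumes "rational_family n M"
    and "\<And>h. 1 < h \<Longrightarrow> h dvd n \<Longrightarrow> h dvd t \<Longrightarrow> (\<lambda>x. of_bool (h dvd x)) \<notin> M" and "f \<in> M"
  shows "f t = f 1"
  using assms
proof (induction "nat n" arbitrary: n M t f rule: less_induct)
  case less
  interpret rational_family n M by (rule less.prems(1))
  show ?case
  proof (rule cell_of_generator_step[OF _ _ less.prems(3)])
    fix m N s f
    assume "0 < m" "m < n" "rational_family m N"
      "\<And>h. 1 < h \<Longrightarrow> h dvd m \<Longrightarrow> h dvd s \<Longrightarrow> (\<lambda>x. of_bool (h dvd x)) \<notin> N" "f \<in> N"
    then show "f s = f 1" by (intro less.hyps[of m N s f]) auto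
  qed (use less.prems(2) in \<open>auto simp: meas_def\<close>)
qed

section \<open>Automorphisms\<close>

text \<open>
  The automorphism acts as \<open>f \<mapsto> f \<circ> \<tau>\<close>; only the basic set of \<open>\<tau> x\<close> matters, not \<open>\<tau> x\<close> itself.
\<close>

locale schur_automorphism = schur_family +
  fixes \<tau> :: "int \<Rightarrow> int"
  assumes aut_closed: "f \<in> M \<Longrightarrow> (\<lambda>x. f (\<tau> x)) \<in> M"
    and aut_conv: "f \<in> M \<Longrightarrow> g \<in> M \<Longrightarrow>
      conv n f g (\<tau> x) = conv n (\<lambda>x. f (\<tau> x)) (\<lambda>x. g (\<tau> x)) x"
    and aut_identity: "n dvd \<tau> x \<longleftrightarrow> n dvd x"
begin

lemma meas_aut: "meas P \<Longrightarrow> meas (\<lambda>x. P (\<tau> x))"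
  unfolding meas_def by (rule aut_closed)

lemma aut_conv_pow:
  assumes f: "f \<in> M"
  shows "conv_pow n f k (\<tau> x) = conv_pow n (\<lambda>x. f (\<tau> x)) k x"
proof (induction k arbitrary: x)
  case (Suc k)
  show ?case
    using aut_conv[OF f conv_pow_closed[OF f, of k], of x] by (simp add: Suc.IH)
qed (simp add: aut_identity)

text \<open>Stated through predicates, because \<open>\<tau>\<close> only picks representatives: v *
  \<open>\<tau>\<close> x and \<open>\<tau>\<close> (v * x) share a basic set but need not be
  congruent.\<close>

definition commuting_unit :: "int \<Rightarrow> bool" where
  "commuting_unit v \<longleftrightarrow> (\<forall>P. meas P \<longrightarrow>
     meas (\<lambda>x. P (v * x)) \<and> (\<forall>x. P (v * \<tau> x) \<longleftrightarrow> P (\<tau> (v * x))))"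

text \<open>
  If \<open>q r \<equiv> 1 (mod n)\<close>, then the \<open>q\<close>-th power of the indicator of a set is congruent modulo \<open>q\<close> to
  the indicator of its preimage under multiplication by \<open>r\<close>.
\<close>

lemma commuting_unit_inverse_prime:
  assumes q: "prime q" and r: "n dvd q * r - 1"
  shows "commuting_unit r"
proof -
  have dvd_iff: "n dvd x - q * i \<longleftrightarrow> n dvd i - r * x" for x i
  proof
    assume "n dvd x - q * i"
    then have "n dvd - (r * (x - q * i)) - (q * r - 1) * i" using r by (intro dvd_diff) simp_all
    also have "- (r * (x - q * i)) - (q * r - 1) * i = i - r * x" by (simp add: algebra_simps)
    finally show "n dvd i - r * x" .
  next
    assume "n dvd i - r * x"
    then have "n dvd - (q * (i - r * x)) - (q * r - 1) * x" using r by (intro dvd_diff) simp_all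
    also have "- (q * (i - r * x)) - (q * r - 1) * x = x - q * i" by (simp add: algebra_simps)
    finally show "n dvd x - q * i" .
  qed
  have frob: "frob q P x = of_bool (P (r * x))" if P: "meas P" for P x
  proof -
    have "frob q P x = (\<Sum>i\<in>{0..<n}. of_bool (n dvd i - r * x) * of_bool (P i))"
      unfolding frob_def by (intro sum.cong refl) (auto simp: dvd_iff)
    then show ?thesis
      using sum_of_bool_residue[OF n_pos periodic[OF P[unfolded meas_def]], of "r * x"] by simp
  qed
  have pow: "P (r * x) \<longleftrightarrow> conv_pow n (\<lambda>x. of_bool (P x)) (nat q) x mod q = 1"
    if P: "meas P" for P x
  proof -
    have "conv_pow n (\<lambda>x. of_bool (P x)) (nat q) x mod q = of_bool (P (r * x)) mod q"
      using conv_pow_frob[OF P q, of x] frob[OF P] by (simp add: mod_eq_dvd_iff)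
    then show ?thesis using prime_gt_1_int[OF q] by auto
  qed
  show ?thesis
    unfolding commuting_unit_def
  proof (intro allI impI conjI)
    fix P x assume P: "meas P"
    have "meas (\<lambda>x. conv_pow n (\<lambda>x. of_bool (P x)) (nat q) x mod q = 1)"
      by (rule meas_fun[OF conv_pow_closed[OF P[unfolded meas_def]]])
    then show "meas (\<lambda>x. P (r * x))" using pow[OF P] by simp
    show "P (r * \<tau> x) \<longleftrightarrow> P (\<tau> (r * x))"
      unfolding pow[OF P] pow[OF meas_aut[OF P]] aut_conv_pow[OF P[unfolded meas_def]] ..
  qed
qed

lemma commuting_unit_cong:
  assumes v: "commuting_unit v" and vw: "v mod n = w mod n"
  shows "commuting_unit w"
  unfolding commuting_unit_def
proof (intro allI impI conjI)
  fix P x assume P: "meas P"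
  have c: "v * x mod n = w * x mod n" for x by (rule mod_mult_cong[OF vw refl])
  have eq: "R (v * x) \<longleftrightarrow> R (w * x)" if "meas R" for R x
    by (rule periodicD[OF meas_periodic[OF that] c])
  have "meas (\<lambda>x. P (v * x))" using v P by (simp add: commuting_unit_def)
  then show "meas (\<lambda>x. P (w * x))" using eq[OF P] by simp
  have "P (v * \<tau> x) \<longleftrightarrow> P (\<tau> (v * x))" using v P by (simp add: commuting_unit_def)
  then show "P (w * \<tau> x) \<longleftrightarrow> P (\<tau> (w * x))" using eq[OF P] eq[OF meas_aut[OF P]] by simp
qed

lemma commuting_unit_mult:
  assumes v: "commuting_unit v" and w: "commuting_unit w"
  shows "commuting_unit (v * w)"
  unfolding commuting_unit_def
proof (intro allI impI conjI)
  fix P x assume P: "meas P"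
  have Pv: "meas (\<lambda>x. P (v * x))" using v P by (simp add: commuting_unit_def)
  then have "meas (\<lambda>x. P (v * (w * x)))" using w unfolding commuting_unit_def by blast
  then show "meas (\<lambda>x. P (v * w * x))" by (simp add: mult.assoc)
  have "P (v * (w * \<tau> x)) \<longleftrightarrow> P (v * \<tau> (w * x))" using w Pv unfolding commuting_unit_def by blast
  also have "\<dots> \<longleftrightarrow> P (\<tau> (v * (w * x)))" using v P unfolding commuting_unit_def by blast
  finally show "P (v * w * \<tau> x) \<longleftrightarrow> P (\<tau> (v * w * x))" by (simp add: mult.assoc)
qed

text \<open>Induction on a positive inverse u of v. If u = q * u' with q prime, then q * v is
  inverse to u' and u' * v is inverse to q, and the product of these two is congruent to v.\<close>

lemma commuting_unit_coprime:
  assumes "coprime v n"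
  shows "commuting_unit v"
proof -
  have *: "commuting_unit v" if "u > 0" "n dvd u * v - 1" for u v
    using that
  proof (induction "nat u" arbitrary: u v rule: less_induct)
    case less
    show ?case
    proof (cases "u = 1")
      case True
      have "commuting_unit 1" by (simp add: commuting_unit_def)
      then show ?thesis
        by (rule commuting_unit_cong) (use less.prems(2) True in \<open>simp add: mod_eq_dvd_iff dvd_diff_commute\<close>)
    next
      case False
      then obtain q where q: "prime q" "q dvd u"
        using prime_divisor_exists[of u] less.prems(1) by auto
      then obtain u' where u': "u = q * u'" by blast
      have q1: "q > 1" using q(1) by (rule prime_gt_1_int)
      then have u'0: "u' > 0" using less.prems(1) u' by (simp add: zero_less_mult_iff)
      then have "u' < u" using u' q1 by simp
      then have "commuting_unit (q * v)"
        by (intro less.hyps[of u']) (use less.prems(2) u' u'0 in \<open>simp_all add: ac_simps\<close>)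
      moreover have "commuting_unit (u' * v)"
        by (rule commuting_unit_inverse_prime[OF q(1)]) (use less.prems(2) u' in \<open>simp add: ac_simps\<close>)
      ultimately have "commuting_unit ((q * v) * (u' * v))" by (rule commuting_unit_mult)
      moreover have "n dvd (u * v - 1) * v" using less.prems(2) by simp
      then have "(q * v) * (u' * v) mod n = v mod n"
        by (simp add: mod_eq_dvd_iff u' algebra_simps)
      ultimately show ?thesis by (rule commuting_unit_cong)
    qed
  qed
  obtain u where u: "[v * u = 1] (mod n)" using assms cong_solve_coprime_int by blast
  have "(u mod n + n) * v mod n = 1 mod n"
  proof -
    have "(u mod n + n) * v mod n = u * v mod n"
      by (rule mod_mult_cong) simp_all
    then show ?thesis using u by (simp add: cong_def mult.commute)
  qed
  then have "n dvd (u mod n + n) * v - 1" by (simp add: mod_eq_dvd_iff)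
  moreover have "u mod n + n > 0" using n_pos by (simp add: add_nonneg_pos)
  ultimately show ?thesis using * by blast
qed

text \<open>The preimage of a subgroup is closed under addition, as convolution detects sums; it is
  therefore a subgroup, and it has the same order.\<close>

lemma aut_fixes_subgroup:
  assumes h: "h > 0" "h dvd n" "meas ((dvd) h)"
  shows "h dvd \<tau> x \<longleftrightarrow> h dvd x"
proof -
  let ?e = "\<lambda>x. of_bool (h dvd x) :: int"
  let ?e' = "\<lambda>x. of_bool (h dvd \<tau> x) :: int"
  define D where "D = {x. h dvd \<tau> x}"
  have eM: "?e \<in> M" using h(3) by (simp add: meas_def)
  have mD: "meas (\<lambda>x. h dvd \<tau> x)" by (rule meas_aut[OF h(3)])
  have "\<exists>k>0. k dvd n \<and> (\<forall>x. x \<in> D \<longleftrightarrow> k dvd x)"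
  proof (rule periodic_additive_set[OF n_pos])
    show "y \<in> D" if "x \<in> D" "x mod n = y mod n" for x y
      using periodicD[OF meas_periodic[OF mD] that(2)] that(1) by (simp add: D_def)
    have "n dvd \<tau> 0" by (simp add: aut_identity)
    then show "0 \<in> D" using h(2) by (auto simp: D_def intro: dvd_trans)
    show "x + y \<in> D" if "x \<in> D" "y \<in> D" for x y
    proof -
      have "h dvd \<tau> (x mod n)" "h dvd \<tau> (x + y - x mod n)"
        using that meas_mod[OF mD, of x] periodicD[OF meas_periodic[OF mD], of "x + y - x mod n" y]
        by (simp_all add: D_def mod_eq_dvd_iff minus_mod_eq_mult_div)
      then have "0 < conv n ?e' ?e' (x + y)"
        unfolding conv_def by (intro sum_pos2[of _ "x mod n"]) (use n_pos in auto)
      then have "conv n ?e ?e (\<tau> (x + y)) \<noteq> 0" using aut_conv[OF eM eM, of "x + y"] by simp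
      then obtain i where "?e i * ?e (\<tau> (x + y) - i) \<noteq> 0"
        unfolding conv_def by (meson sum.neutral)
      then have "h dvd i" "h dvd \<tau> (x + y) - i" by (auto split: if_splits)
      then have "h dvd i + (\<tau> (x + y) - i)" by (rule dvd_add)
      then show ?thesis by (simp add: D_def)
    qed
  qed
  then obtain k where k: "k > 0" "k dvd n" "\<And>x. h dvd \<tau> x \<longleftrightarrow> k dvd x" by (auto simp: D_def)
  have one: "(\<lambda>_. 1) \<in> M" using meas_const[of True] by (simp add: meas_def)
  \<comment> \<open>Convolution of an indicator with the constant 1 gives the size of the
    set.\<close>
  have "n div h = conv n ?e (\<lambda>_. 1) (\<tau> 0)"
    using card_residue_class[OF h(2,1), of 0] n_pos by (simp add: conv_def)
  also have "\<dots> = conv n ?e' (\<lambda>_. 1) 0" by (rule aut_conv[OF eM one])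
  also have "\<dots> = n div k"
    using card_residue_class[OF k(2,1), of 0] n_pos by (simp add: conv_def k(3))
  finally have "h * (n div h) = k * (n div h) \<and> n div h \<noteq> 0" using h k n_pos by auto
  then have "h = k" by auto
  then show ?thesis using k(3) by simp
qed

text \<open>Multiplication by a unit permutes the residues and is compatible with convolution, and
  equal gcd means equal up to a unit.\<close>

lemma rational_part: "rational_family n {f \<in> M. \<forall>x y. gcd x n = gcd y n \<longrightarrow> f x = f y}"
proof unfold_locales
  let ?N = "{f \<in> M. \<forall>x y. gcd x n = gcd y n \<longrightarrow> f x = f y}"
  show "n > 0" by (rule n_pos)
  show "periodic n f" if "f \<in> ?N" for f using that periodic by simp
  show "f x = f y" if "f \<in> ?N" "gcd x n = gcd y n" for f x y using that by blast
  show "(\<lambda>x. F (f x) (g x)) \<in> ?N" if fg: "f \<in> ?N" "g \<in> ?N" for f g and F :: "int \<Rightarrow> int \<Rightarrow> int"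
  proof -
    have f: "f \<in> M" "\<And>x y. gcd x n = gcd y n \<Longrightarrow> f x = f y"
      and g: "g \<in> M" "\<And>x y. gcd x n = gcd y n \<Longrightarrow> g x = g y" using fg by blast+
    have "F (f x) (g x) = F (f y) (g y)" if "gcd x n = gcd y n" for x y
      by (rule arg_cong2[OF f(2)[OF that] g(2)[OF that]])
    then show ?thesis using pointwise2[OF f(1) g(1)] by blast
  qed
  have dvd: "n dvd x \<longleftrightarrow> n dvd y" if "gcd x n = gcd y n" for x y
    using that by (metis gcd_proj2_iff gcd.commute)
  have "(of_bool (n dvd x) :: int) = of_bool (n dvd y)" if "gcd x n = gcd y n" for x y
    using dvd[OF that] by simp
  then show "(\<lambda>x. of_bool (n dvd x)) \<in> ?N" using identity by blast
  show "conv n f g \<in> ?N" if fg: "f \<in> ?N" "g \<in> ?N" for f g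
  proof -
    have inv: "k (u * x) = k x" if "k \<in> ?N" "coprime u n" for k u x
    proof -
      have "gcd (u * x) n = gcd x n"
        using that(2) by (simp add: gcd_mult_left_left_cancel coprime_commute)
      then show ?thesis using that(1) by blast
    qed
    have "conv n f g x = conv n f g y" if xy: "gcd x n = gcd y n" for x y
    proof -
      obtain u where u: "coprime u n" "u * x mod n = y mod n"
        using gcd_eq_imp_unit_multiple[OF xy n_pos] by blast
      have fM: "f \<in> M" and gM: "g \<in> M" using fg by blast+
      have per: "periodic n (\<lambda>i. f i * g (y - i))"
        by (rule periodic_conv_summand[OF periodic[OF fM] periodic[OF gM]])
      have "conv n f g x = (\<Sum>i\<in>{0..<n}. f (u * i) * g (u * (x - i)))"
        using inv[OF fg(1) u(1)] inv[OF fg(2) u(1)] by (simp add: conv_def)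
      also have "\<dots> = (\<Sum>i\<in>{0..<n}. f (u * i) * g (y - u * i))"
      proof (intro sum.cong refl arg_cong2[of _ _ _ _ "(*)"])
        fix i
        show "g (u * (x - i)) = g (y - u * i)"
          unfolding right_diff_distrib
          by (rule periodicD[OF periodic[OF gM] mod_diff_cong[OF u(2) refl]])
      qed
      also have "\<dots> = conv n f g y"
        unfolding conv_def
      proof (rule sum_periodic_reindex[OF n_pos per, of "\<lambda>i. u * i"])
        fix i j assume "u * i mod n = u * j mod n"
        then have "n dvd u * (i - j)" by (simp add: mod_eq_dvd_iff right_diff_distrib)
        then show "i mod n = j mod n"
          using u(1) by (simp add: mod_eq_dvd_iff coprime_dvd_mult_right_iff coprime_commute)
      qed
      finally show ?thesis .
    qed
    then show ?thesis using conv fg by blast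
  qed
qed

text \<open>The unit multiples of the basic set of \<open>\<tau>\<close> x form a rational S-set R.
  As x and \<open>\<tau>\<close> x are not separated by the rational part, R contains x along with
  \<open>\<tau>\<close> x.\<close>

lemma aut_eq_unit:
  "\<exists>u. coprime u n \<and> (\<forall>P. meas P \<longrightarrow> (P (\<tau> x) \<longleftrightarrow> P (u * x)))"
proof -
  define N where "N = {f \<in> M. \<forall>x y. gcd x n = gcd y n \<longrightarrow> f x = f y}"
  interpret N: rational_family n N unfolding N_def by (rule rational_part)
  have "N \<subseteq> M" unfolding N_def by blast
  then have NM: "N.meas P \<Longrightarrow> meas P" for P unfolding N.meas_def meas_def by blast
  \<comment> \<open>The largest such h gives the smallest subgroup of the rational part that
    contains x.\<close>
  define H where "H = {h \<in> {1..n}. h dvd n \<and> h dvd x \<and> N.meas ((dvd) h)}"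
  have finH: "finite H" unfolding H_def by (rule finite_subset[of _ "{1..n}"]) auto
  have "(dvd) 1 = (\<lambda>_::int. True)" by (intro ext) simp
  then have "1 \<in> H" using n_pos N.meas_const[of True] by (simp add: H_def)
  then have "Max H \<in> H" using finH by (intro Max_in) auto
  define h where "h = Max H"
  have h: "h > 0" "h dvd n" "h dvd x" "N.meas ((dvd) h)"
    using \<open>Max H \<in> H\<close> by (auto simp: H_def h_def)
  have h_max: "k \<le> h" if "k \<in> H" for k unfolding h_def using finH that by (rule Max_ge)
  \<comment> \<open>The automorphism fixes these subgroups, so hZ is also the smallest one
    containing \<open>\<tau>\<close> x. Inside it x and \<open>\<tau>\<close> x both lie in the
    basic set of its generator h.\<close>
  have f_h: "f z = f h" if z: "z = x \<or> z = \<tau> x" and f: "f \<in> N" for f z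
  proof -
    have "h dvd z" using z h aut_fixes_subgroup[OF h(1,2) NM[OF h(4)]] by auto
    then obtain s where s: "z = h * s" by blast
    have "f (h * s) = f (h * 1)"
    proof (rule cell_of_generator[OF N.rational_family_subgroup[OF h(2,1,4)]])
      show "(\<lambda>x. f (h * x)) \<in> (\<lambda>f x. f (h * x)) ` N" using f by (rule imageI)
      fix k assume k: "1 < k" "k dvd n div h" "k dvd s"
      show "(\<lambda>x. of_bool (k dvd x)) \<notin> (\<lambda>f x. f (h * x)) ` N"
      proof
        assume "(\<lambda>x. of_bool (k dvd x)) \<in> (\<lambda>f x. f (h * x)) ` N"
        then have hk: "N.meas ((dvd) (h * k))" by (rule N.meas_dvd_of_subgroup) (use h in auto)
        have "h * k dvd h * (n div h)" using k(2) by (intro mult_dvd_mono) auto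
        then have hkn: "h * k dvd n" using h(2) by simp
        have hk0: "h * k > 0" using h(1) k(1) by simp
        have "h * k dvd z" unfolding s using k(3) by (intro mult_dvd_mono) auto
        then have "h * k dvd x" using z aut_fixes_subgroup[OF hk0 hkn NM[OF hk]] by auto
        then have "h * k \<in> H"
          using hk hkn hk0 zdvd_imp_le[OF hkn n_pos] by (auto simp: H_def)
        then have "h * k \<le> h" by (rule h_max)
        then show False using h(1) k(1) by simp
      qed
    qed
    then show ?thesis using s by simp
  qed
  \<comment> \<open>Units are taken in one period so that R is a finite union of S-sets.\<close>
  define R where "R y \<longleftrightarrow> (\<exists>u\<in>{0..<n}. coprime u n \<and> cell (\<tau> x) (u * y))" for y
  have percell: "cell (\<tau> x) a \<longleftrightarrow> cell (\<tau> x) b" if "a mod n = b mod n" for a b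
    by (rule periodicD[OF meas_periodic[OF meas_cell] that])
  have RI: "R y" if "coprime u n" "cell (\<tau> x) (u * y)" for u y
    unfolding R_def
  proof (intro bexI[of _ "u mod n"] conjI)
    show "coprime (u mod n) n" using that(1) n_pos by simp
    show "cell (\<tau> x) (u mod n * y)"
      using percell[of "u mod n * y" "u * y"] that(2) by (simp add: mod_mult_left_eq)
  qed (use n_pos in auto)
  have "meas (\<lambda>y. coprime u n \<and> cell (\<tau> x) (u * y))" for u
  proof (cases "coprime u n")
    case True
    then show ?thesis
      using commuting_unit_coprime[OF True] meas_cell[of "\<tau> x"] by (simp add: commuting_unit_def)
  qed (simp add: meas_const)
  then have mR: "meas R" unfolding R_def by (intro meas_finite_Bex) auto
  have R_gcd: "R y" if yz: "gcd y n = gcd z n" and "R z" for y z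
  proof -
    obtain u where u: "coprime u n" "cell (\<tau> x) (u * z)" using \<open>R z\<close> by (auto simp: R_def)
    obtain w where w: "coprime w n" "w * y mod n = z mod n"
      using gcd_eq_imp_unit_multiple[OF yz n_pos] by blast
    have "u * (w * y) mod n = u * z mod n" by (rule mod_mult_cong[OF refl w(2)])
    then have "cell (\<tau> x) (u * (w * y))" using percell u(2) by blast
    then have "cell (\<tau> x) (u * w * y)" by (simp only: mult.assoc)
    then show ?thesis by (rule RI[rotated]) (simp add: u(1) w(1))
  qed
  have "(of_bool (R y) :: int) = of_bool (R z)" if "gcd y n = gcd z n" for y z
    using R_gcd[OF that] R_gcd[OF that[symmetric]] by auto
  then have "(\<lambda>y. of_bool (R y)) \<in> N" using mR unfolding N_def meas_def by blast
  then have "R x \<longleftrightarrow> R (\<tau> x)" using f_h[of x] f_h[of "\<tau> x"] by (metis of_bool_eq_iff)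
  moreover have "R (\<tau> x)" by (rule RI[of 1]) (simp_all add: cell_refl)
  ultimately obtain u where "coprime u n" "cell (\<tau> x) (u * x)" by (auto simp: R_def)
  then show ?thesis using cell_meas by blast
qed

end

text \<open>At the given x, \<open>\<tau>\<close> and \<open>\<sigma>\<close> may be replaced by
  units u and w once the other map has been moved past the unit, and u * w = w * u.\<close>

theorem schur_automorphisms_commute:
  assumes "schur_automorphism n M \<tau>" "schur_automorphism n M \<sigma>" and f: "f \<in> M"
  shows "f (\<tau> (\<sigma> x)) = f (\<sigma> (\<tau> x))"
proof -
  interpret t: schur_automorphism n M \<tau> by fact
  interpret s: schur_automorphism n M \<sigma> by fact
  obtain u where u: "coprime u n" "\<And>P. t.meas P \<Longrightarrow> P (\<tau> x) \<longleftrightarrow> P (u * x)"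
    using t.aut_eq_unit by blast
  obtain w where w: "coprime w n" "\<And>P. t.meas P \<Longrightarrow> P (\<sigma> x) \<longleftrightarrow> P (w * x)"
    using s.aut_eq_unit by blast
  have t_unit: "P (v * \<tau> x) \<longleftrightarrow> P (\<tau> (v * x))" "t.meas (\<lambda>x. P (v * x))"
    if "coprime v n" "t.meas P" for v P
    using t.commuting_unit_coprime[OF that(1)] that(2) by (simp_all add: t.commuting_unit_def)
  have s_unit: "P (v * \<sigma> x) \<longleftrightarrow> P (\<sigma> (v * x))" if "coprime v n" "t.meas P" for v P
    using s.commuting_unit_coprime[OF that(1)] that(2) by (simp add: s.commuting_unit_def)
  define P where "P y \<longleftrightarrow> f y = f (\<tau> (\<sigma> x))" for y
  have P: "t.meas P" unfolding P_def by (rule t.meas_fun[OF f])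
  have "P (\<tau> (\<sigma> x)) \<longleftrightarrow> P (\<tau> (w * x))" by (rule w(2)[OF t.meas_aut[OF P]])
  also have "\<dots> \<longleftrightarrow> P (w * \<tau> x)" using t_unit(1)[OF w(1) P] by simp
  also have "\<dots> \<longleftrightarrow> P (w * (u * x))" by (rule u(2)[OF t_unit(2)[OF w(1) P]])
  also have "\<dots> \<longleftrightarrow> P (u * (w * x))" by (simp add: mult.left_commute)
  also have "\<dots> \<longleftrightarrow> P (u * \<sigma> x)" by (rule w(2)[OF t_unit(2)[OF u(1) P], symmetric])
  also have "\<dots> \<longleftrightarrow> P (\<sigma> (u * x))" by (rule s_unit[OF u(1) P])
  also have "\<dots> \<longleftrightarrow> P (\<sigma> (\<tau> x))" by (rule u(2)[OF s.meas_aut[OF P], symmetric])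
  finally show ?thesis by (simp add: P_def)
qed

section \<open>S-rings over cyclic groups\<close>

lemma ring_iso_restrict_carrier:
  "\<phi> \<in> ring_iso (R\<lparr>carrier := S\<rparr>) (R\<lparr>carrier := S\<rparr>) \<longleftrightarrow>
    bij_betw \<phi> S S \<and> \<phi> \<one>\<^bsub>R\<^esub> = \<one>\<^bsub>R\<^esub> \<and>
    (\<forall>x\<in>S. \<forall>y\<in>S. \<phi> (x \<otimes>\<^bsub>R\<^esub> y) = \<phi> x \<otimes>\<^bsub>R\<^esub> \<phi> y \<and> \<phi> (x \<oplus>\<^bsub>R\<^esub> y) = \<phi> x \<oplus>\<^bsub>R\<^esub> \<phi> y)"
  by (auto simp: ring_iso_def ring_hom_def dest: bij_betw_imp_funcset)

lemma group_schur_Aut: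
  assumes S: "schur_ring G S" and fin: "finite (carrier G)"
  shows "group (schur_Aut G S)"
proof -
  let ?R = "group_algebra G" and ?Q = "basic_quantities G S"
  let ?H = "Bij S \<inter> schur_iso G S G S"
  have sub: "subring S ?R" and vs: "fvec.subspace S" using S by (auto simp: schur_ring_def)
  have part: "schur_partition G S (basic_sets G S)" by (rule schur_partition_basic_sets[OF S])
  have QS: "?Q \<subseteq> S"
    using part fvec.span_superset[of ?Q] by (simp add: basic_quantities_def schur_partition_def)
  have finQ: "finite ?Q"
    using part finite_elements[OF fin] by (auto simp: basic_quantities_def schur_partition_def)
  have mult: "x \<otimes>\<^bsub>?R\<^esub> y \<in> S" and add: "x \<oplus>\<^bsub>?R\<^esub> y \<in> S" if "x \<in> S" "y \<in> S" for x y
    using subringE(6,7)[OF sub] that by auto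
  have one: "\<one>\<^bsub>?R\<^esub> \<in> S" by (rule subringE(3)[OF sub])
  have scale: "fscale c f \<in> S" if "f \<in> S" for c f by (rule fvec.subspace_scale[OF vs that])
  have memD: "bij_betw \<phi> S S" "\<phi> \<in> extensional S" "\<phi> \<one>\<^bsub>?R\<^esub> = \<one>\<^bsub>?R\<^esub>" "\<phi> ` ?Q \<subseteq> ?Q"
    "\<And>x y. x \<in> S \<Longrightarrow> y \<in> S \<Longrightarrow> \<phi> (x \<otimes>\<^bsub>?R\<^esub> y) = \<phi> x \<otimes>\<^bsub>?R\<^esub> \<phi> y"
    "\<And>x y. x \<in> S \<Longrightarrow> y \<in> S \<Longrightarrow> \<phi> (x \<oplus>\<^bsub>?R\<^esub> y) = \<phi> x \<oplus>\<^bsub>?R\<^esub> \<phi> y"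
    "\<And>c f. f \<in> S \<Longrightarrow> \<phi> (fscale c f) = fscale c (\<phi> f)" if "\<phi> \<in> ?H" for \<phi>
    using that by (auto simp: schur_iso_def ring_iso_restrict_carrier Bij_def)
  have memI: "\<phi> \<in> ?H" if "\<phi> \<in> Bij S" "\<phi> \<one>\<^bsub>?R\<^esub> = \<one>\<^bsub>?R\<^esub>" "\<phi> ` ?Q \<subseteq> ?Q"
    "\<And>x y. x \<in> S \<Longrightarrow> y \<in> S \<Longrightarrow> \<phi> (x \<otimes>\<^bsub>?R\<^esub> y) = \<phi> x \<otimes>\<^bsub>?R\<^esub> \<phi> y"
    "\<And>x y. x \<in> S \<Longrightarrow> y \<in> S \<Longrightarrow> \<phi> (x \<oplus>\<^bsub>?R\<^esub> y) = \<phi> x \<oplus>\<^bsub>?R\<^esub> \<phi> y"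
    "\<And>c f. f \<in> S \<Longrightarrow> \<phi> (fscale c f) = fscale c (\<phi> f)" for \<phi>
    using that by (auto simp: schur_iso_def ring_iso_restrict_carrier Bij_def)
  have maps: "\<phi> f \<in> S" if "\<phi> \<in> ?H" "f \<in> S" for \<phi> f
    using bij_betw_apply[OF memD(1)[OF that(1)] that(2)] .
  have "subgroup ?H (BijGroup S)"
  proof (rule group.subgroupI[OF group_BijGroup])
    show "?H \<subseteq> carrier (BijGroup S)" by (auto simp: BijGroup_def)
    have "(\<lambda>x\<in>S. x) \<in> ?H"
      by (rule memI) (use QS mult add one scale id_Bij in auto)
    then show "?H \<noteq> {}" by blast
  next
    fix \<phi> assume \<phi>: "\<phi> \<in> ?H"
    note h = memD[OF \<phi>]
    define \<psi> where "\<psi> = (\<lambda>x\<in>S. inv_into S \<phi> x)"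
    have \<psi>S: "\<psi> x \<in> S" "\<phi> (\<psi> x) = x" if "x \<in> S" for x
      using that h(1) by (auto simp: \<psi>_def bij_betw_def f_inv_into_f inv_into_into)
    have \<psi>\<phi>: "\<psi> (\<phi> x) = x" if "x \<in> S" for x
      using that h(1) maps[OF \<phi> that] by (simp add: \<psi>_def bij_betw_inv_into_left)
    \<comment> \<open>An isomorphism only maps basic quantities into basic quantities; finiteness
      upgrades this to equality, which the inverse requires.\<close>
    have "\<phi> ` ?Q = ?Q"
      using h(1,4) QS by (intro endo_inj_surj finQ) (auto simp: bij_betw_def intro: inj_on_subset)
    have "\<psi> ` ?Q \<subseteq> ?Q"
    proof (rule image_subsetI)
      fix q assume "q \<in> ?Q"
      then obtain r where r: "r \<in> ?Q" "q = \<phi> r" using \<open>\<phi> ` ?Q = ?Q\<close> by blast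
      then have "\<psi> q = r" using \<psi>\<phi> QS by blast
      then show "\<psi> q \<in> ?Q" using r by simp
    qed
    moreover have "\<psi> (x \<otimes>\<^bsub>?R\<^esub> y) = \<psi> x \<otimes>\<^bsub>?R\<^esub> \<psi> y" "\<psi> (x \<oplus>\<^bsub>?R\<^esub> y) = \<psi> x \<oplus>\<^bsub>?R\<^esub> \<psi> y"
      if "x \<in> S" "y \<in> S" for x y
      using \<psi>\<phi>[OF mult[OF \<psi>S(1) \<psi>S(1), OF that]] \<psi>\<phi>[OF add[OF \<psi>S(1) \<psi>S(1), OF that]]
        h(5,6)[OF \<psi>S(1) \<psi>S(1), OF that] \<psi>S(2) that by simp_all
    moreover have "\<psi> (fscale c f) = fscale c (\<psi> f)" if "f \<in> S" for c f
      using \<psi>\<phi>[OF scale[OF \<psi>S(1)[OF that]], of c] h(7)[OF \<psi>S(1)[OF that], of c] \<psi>S(2)[OF that]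
      by simp
    moreover have "\<psi> \<one>\<^bsub>?R\<^esub> = \<one>\<^bsub>?R\<^esub>" using \<psi>\<phi>[OF one] h(3) by simp
    moreover have "\<psi> \<in> Bij S" unfolding \<psi>_def by (rule restrict_inv_into_Bij) (use \<phi> in simp)
    ultimately have "\<psi> \<in> ?H" by (intro memI)
    then show "inv\<^bsub>BijGroup S\<^esub> \<phi> \<in> ?H" using \<phi> by (simp add: inv_BijGroup \<psi>_def)
  next
    fix \<phi> \<psi> assume \<phi>: "\<phi> \<in> ?H" and \<psi>: "\<psi> \<in> ?H"
    have comp: "compose S \<phi> \<psi> f = \<phi> (\<psi> f)" if "f \<in> S" for f
      using that by (simp add: compose_def)
    have "compose S \<phi> \<psi> \<in> ?H"
    proof (rule memI)
      show "compose S \<phi> \<psi> \<in> Bij S" by (rule compose_Bij) (use \<phi> \<psi> in blast)+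
      show "compose S \<phi> \<psi> ` ?Q \<subseteq> ?Q"
      proof (rule image_subsetI)
        fix q assume q: "q \<in> ?Q"
        then have "\<phi> (\<psi> q) \<in> ?Q" using memD(4)[OF \<phi>] memD(4)[OF \<psi>] by blast
        then show "compose S \<phi> \<psi> q \<in> ?Q" using comp QS q by auto
      qed
    qed (simp_all only: comp one mult add scale maps[OF \<psi>] memD(3,5-7)[OF \<phi>] memD(3,5-7)[OF \<psi>])
    then show "\<phi> \<otimes>\<^bsub>BijGroup S\<^esub> \<psi> \<in> ?H" using \<phi> \<psi> by (simp add: BijGroup_def)
  qed
  then show ?thesis
    unfolding schur_Aut_def by (rule group.subgroup_imp_group[OF group_BijGroup])
qed

section \<open>From S-rings over cyclic groups to integer-valued functions\<close>

lemma group_algebra_mult_cyclic: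
  fixes f g :: "int \<Rightarrow> 'f::field"
  assumes n: "n > 0" and x: "x \<in> {0..<int n}"
  shows "(f \<otimes>\<^bsub>group_algebra (integer_mod_group n)\<^esub> g) x =
    (\<Sum>i\<in>{0..<int n}. f i * g ((x - i) mod int n))"
proof -
  have "(f \<otimes>\<^bsub>group_algebra (integer_mod_group n)\<^esub> g) x =
      (\<Sum>(y, z)\<in>{(y, z) \<in> {0..<int n} \<times> {0..<int n}. (y + z) mod int n = x}. f y * g z)"
    using n by (simp add: group_algebra_def carrier_integer_mod_group)
  also have "{(y, z) \<in> {0..<int n} \<times> {0..<int n}. (y + z) mod int n = x} =
      (\<lambda>i. (i, (x - i) mod int n)) ` {0..<int n}" (is "?A = ?B")
  proof (intro equalityI subsetI)
    fix p assume "p \<in> ?A"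
    then obtain y z where p: "p = (y, z)" "y \<in> {0..<int n}" "z \<in> {0..<int n}" "(y + z) mod int n = x"
      by blast
    have "(x - y) mod int n = z mod int n" unfolding p(4)[symmetric] by (simp add: mod_diff_left_eq)
    then have "(x - y) mod int n = z" using p(3) by simp
    then show "p \<in> ?B" using p(1,2) by (intro image_eqI[of _ _ y]) auto
  next
    fix p assume "p \<in> ?B"
    then obtain i where i: "i \<in> {0..<int n}" "p = (i, (x - i) mod int n)" by blast
    have "(i + (x - i) mod int n) mod int n = x" using x by (simp add: mod_add_right_eq)
    then show "p \<in> ?A" using i n by simp
  qed
  also have "(\<Sum>(y, z)\<in>?B. f y * g z) = (\<Sum>i\<in>{0..<int n}. f i * g ((x - i) mod int n))"
    by (subst sum.reindex) (simp_all add: inj_on_def)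
  finally show ?thesis .
qed

locale cyclic_schur_ring =
  fixes n :: nat and S :: "(int \<Rightarrow> 'f::field_char_0) set"
  assumes n_pos: "n > 0" and schur_ring: "schur_ring (integer_mod_group n) S"
begin

abbreviation "N \<equiv> int n"
abbreviation "G \<equiv> integer_mod_group n"
abbreviation "R \<equiv> group_algebra (integer_mod_group n) :: (int \<Rightarrow> 'f) ring"

definition B :: "int set set" where
  "B = basic_sets G S"

text \<open>Characteristic 0 makes \<open>of_int\<close> injective, so identities between
  integer-valued functions can be read back from the group algebra.\<close>

definition lift :: "(int \<Rightarrow> int) \<Rightarrow> int \<Rightarrow> 'f" where
  "lift f x = (if x \<in> {0..<N} then of_int (f x) else 0)"

definition M :: "(int \<Rightarrow> int) set" where
  "M = {f. periodic N f \<and> (\<forall>C\<in>B. \<forall>x\<in>C. \<forall>y\<in>C. f x = f y)}"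

lemma partition: "partition_on {0..<N} B" and zero_class: "{0} \<in> B"
  and span: "fvec.span (indicator ` B) = S"
  using schur_partition_basic_sets[OF schur_ring] n_pos
  by (simp_all add: B_def schur_partition_def carrier_integer_mod_group)

lemma class_subset: "C \<in> B \<Longrightarrow> x \<in> C \<Longrightarrow> x \<in> {0..<N}"
  using partition_onD1[OF partition] by blast

lemma class_exists:
  assumes "x \<in> {0..<N}"
  obtains C where "C \<in> B" "x \<in> C"
  using partition_onD1[OF partition] assms by blast

lemma class_unique: "C \<in> B \<Longrightarrow> D \<in> B \<Longrightarrow> x \<in> C \<Longrightarrow> x \<in> D \<Longrightarrow> C = D"
  using partition_onD2[OF partition] by (meson disjointD disjoint_iff)

lemma finite_B: "finite B"
  by (rule finite_elements[OF _ partition]) simp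

lemma subring: "subring S R"
  using schur_ring by (simp add: schur_ring_def)

lemma S_vanish: "g \<in> S \<Longrightarrow> x \<notin> {0..<N} \<Longrightarrow> g x = 0"
  using subringE(1)[OF subring] n_pos by (auto simp: group_algebra_def carrier_integer_mod_group)

lemma S_constant: "g \<in> S \<Longrightarrow> C \<in> B \<Longrightarrow> x \<in> C \<Longrightarrow> y \<in> C \<Longrightarrow> g x = g y"
  using span_indicator_constant[OF partition] span by blast

lemma S_I:
  assumes vanish: "\<And>x. x \<notin> {0..<N} \<Longrightarrow> g x = 0"
    and const: "\<And>C x y. C \<in> B \<Longrightarrow> x \<in> C \<Longrightarrow> y \<in> C \<Longrightarrow> g x = g y"
  shows "g \<in> S"
proof -
  define rep where "rep C = (SOME x. x \<in> C)" for C :: "int set"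
  have rep: "rep C \<in> C" if "C \<in> B" for C
    unfolding rep_def using partition_onD3[OF partition] that by (metis some_in_eq)
  define s where "s = (\<Sum>C\<in>B. fscale (g (rep C)) (indicator C))"
  have "(\<Sum>C\<in>A. fscale (g (rep C)) (indicator C)) x = (\<Sum>C\<in>A. g (rep C) * indicator C x)"
    for x and A :: "int set set"
    by (induction A rule: infinite_finite_induct) (simp_all add: fscale_def)
  then have s: "s x = (\<Sum>C\<in>B. g (rep C) * indicator C x)" for x by (simp add: s_def)
  have "s x = g x" for x
  proof (cases "x \<in> {0..<N}")
    case True
    then obtain D where D: "D \<in> B" "x \<in> D" by (rule class_exists)
    have "s x = (\<Sum>C\<in>{D}. g (rep C) * indicator C x)"
      unfolding s
      by (rule sum.mono_neutral_right)
        (use finite_B D class_unique in \<open>auto simp: indicator_def\<close>)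
    then show ?thesis using D const[OF D(1) rep[OF D(1)] D(2)] by simp
  next
    case False
    then have "s x = 0"
      unfolding s using class_subset by (intro sum.neutral) (auto simp: indicator_def)
    then show ?thesis using vanish[OF False] by simp
  qed
  then have "g = s" by (simp add: fun_eq_iff)
  also have "s \<in> fvec.span (indicator ` B)"
    unfolding s_def by (intro fvec.span_sum fvec.span_scale fvec.span_base) simp
  finally show ?thesis using span by simp
qed

lemma lift_eq_iff: "lift f = lift g \<longleftrightarrow> (\<forall>x\<in>{0..<N}. f x = g x)"
proof
  assume eq: "lift f = lift g"
  show "\<forall>x\<in>{0..<N}. f x = g x"
  proof
    fix x assume "x \<in> {0..<N}"
    then show "f x = g x" using fun_cong[OF eq, of x] by (simp add: lift_def)
  qed
qed (simp add: lift_def fun_eq_iff)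

lemma M_constant: "f \<in> M \<Longrightarrow> C \<in> B \<Longrightarrow> x \<in> C \<Longrightarrow> y \<in> C \<Longrightarrow> f x = f y"
  unfolding M_def by blast

lemma lift_in_S:
  assumes "f \<in> M"
  shows "lift f \<in> S"
proof (rule S_I)
  fix C x y assume C: "C \<in> B" "x \<in> C" "y \<in> C"
  show "lift f x = lift f y"
    using M_constant[OF assms C] class_subset[OF C(1)] C(2,3) by (simp add: lift_def)
qed (auto simp: lift_def)

lemma lift_mult:
  assumes f: "periodic N f" and g: "periodic N g"
  shows "lift f \<otimes>\<^bsub>R\<^esub> lift g = lift (conv N f g)"
proof
  fix x
  show "(lift f \<otimes>\<^bsub>R\<^esub> lift g) x = lift (conv N f g) x"
  proof (cases "x \<in> {0..<N}")
    case True
    have "(lift f \<otimes>\<^bsub>R\<^esub> lift g) x = (\<Sum>i\<in>{0..<N}. lift f i * lift g ((x - i) mod N))"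
      by (rule group_algebra_mult_cyclic[OF n_pos True])
    also have "\<dots> = (\<Sum>i\<in>{0..<N}. of_int (f i * g (x - i)))"
    proof (rule sum.cong[OF refl])
      fix i assume i: "i \<in> {0..<N}"
      have "g ((x - i) mod N) = g (x - i)" by (rule periodicD[OF g]) simp
      then show "lift f i * lift g ((x - i) mod N) = (of_int (f i * g (x - i)) :: 'f)"
        using i n_pos by (simp add: lift_def)
    qed
    also have "\<dots> = lift (conv N f g) x" using True by (simp add: lift_def conv_def)
    finally show ?thesis .
  next
    case False
    then have empty: "{(y, z) \<in> {0..<N} \<times> {0..<N}. (y + z) mod N = x} = {}" using n_pos by auto
    have "(lift f \<otimes>\<^bsub>R\<^esub> lift g) x =
        (\<Sum>(y, z)\<in>{(y, z) \<in> {0..<N} \<times> {0..<N}. (y + z) mod N = x}. lift f y * lift g z)"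
      using n_pos by (simp add: group_algebra_def carrier_integer_mod_group)
    also have "\<dots> = 0" unfolding empty by simp
    also have "\<dots> = lift (conv N f g) x" using False by (simp only: lift_def if_False)
    finally show ?thesis .
  qed
qed

lemma periodic_conv:
  assumes "periodic N g"
  shows "periodic N (conv N f g)"
proof (rule periodicI)
  fix x y assume xy: "x mod N = y mod N"
  have "g (x - i) = g (y - i)" for i
    by (rule periodicD[OF assms mod_diff_cong[OF xy refl]])
  then show "conv N f g x = conv N f g y" by (simp add: conv_def)
qed

lemma M_I:
  assumes "periodic N f" "lift f \<in> S"
  shows "f \<in> M"
  unfolding M_def
proof (intro CollectI conjI ballI assms(1))
  fix C x y assume C: "C \<in> B" "x \<in> C" "y \<in> C"
  show "f x = f y"
    using S_constant[OF assms(2) C] class_subset[OF C(1)] C(2,3) by (simp add: lift_def)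
qed

lemma schur_family: "schur_family N M"
proof unfold_locales
  show "N > 0" using n_pos by simp
  show per: "periodic N f" if "f \<in> M" for f using that by (simp add: M_def)
  show "(\<lambda>x. F (f x) (g x)) \<in> M" if fg: "f \<in> M" "g \<in> M"
    for f g :: "int \<Rightarrow> int" and F :: "int \<Rightarrow> int \<Rightarrow> int"
    unfolding M_def
  proof (intro CollectI conjI ballI periodicI)
    fix x y assume "x mod N = y mod N"
    then show "F (f x) (g x) = F (f y) (g y)"
      using periodicD[OF per[OF fg(1)]] periodicD[OF per[OF fg(2)]] by metis
  next
    fix C x y assume C: "C \<in> B" "x \<in> C" "y \<in> C"
    show "F (f x) (g x) = F (f y) (g y)"
      by (rule arg_cong2[OF M_constant[OF fg(1) C] M_constant[OF fg(2) C]])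
  qed
  show "(\<lambda>x. of_bool (N dvd x)) \<in> M"
  proof (rule M_I)
    show "periodic N (\<lambda>x. of_bool (N dvd x) :: int)"
      by (rule periodicI) (simp add: dvd_eq_mod_eq_0)
    have "lift (\<lambda>x. of_bool (N dvd x)) x = indicator {0} x" for x
    proof (cases "x \<in> {0..<N}")
      case True
      then have "N dvd x \<longleftrightarrow> x = 0" using zdvd_not_zless[of x N] by (cases "x = 0") auto
      then show ?thesis using True by (simp add: lift_def indicator_def)
    next
      case False
      then have "x \<noteq> 0" using n_pos by auto
      then show ?thesis using False by (simp only: lift_def if_False indicator_simps singleton_iff not_False_eq_True)
    qed
    then have "lift (\<lambda>x. of_bool (N dvd x)) = indicator {0}" by (intro ext)
    then show "lift (\<lambda>x. of_bool (N dvd x)) \<in> S"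
      using fvec.span_base[of "indicator {0}" "indicator ` B"] zero_class span by auto
  qed
  show "conv N f g \<in> M" if fg: "f \<in> M" "g \<in> M" for f g
  proof (rule M_I[OF periodic_conv[OF per[OF fg(2)]]])
    have "lift f \<otimes>\<^bsub>R\<^esub> lift g \<in> S"
      by (intro subringE(6)[OF subring] lift_in_S fg)
    then show "lift (conv N f g) \<in> S" by (simp add: lift_mult[OF per per, OF fg])
  qed
qed

lemma indicator_in_S: "C \<in> B \<Longrightarrow> indicator C \<in> S"
  using fvec.span_base[of "indicator C" "indicator ` B"] span by auto

lemma indicator_inj: "(indicator C :: int \<Rightarrow> 'f) = indicator D \<Longrightarrow> C = D"
  unfolding fun_eq_iff indicator_def of_bool_eq_iff by blast

text \<open>\<open>\<phi>\<close> permutes the basic quantities. For x in the basic set D,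
  \<open>\<tau>\<close> x is any point of the C whose indicator is sent to that of D;
  \<open>\<phi>\<close> then acts by composition with \<open>\<tau>\<close>.\<close>

lemma automorphism_induced:
  assumes \<phi>: "\<phi> \<in> schur_iso G S G S"
  shows "\<exists>\<tau>. schur_automorphism N M \<tau> \<and> (\<forall>x. \<tau> x \<in> {0..<N}) \<and>
    (\<forall>g\<in>S. \<forall>x\<in>{0..<N}. \<phi> g x = g (\<tau> x))"
proof -
  have "\<phi> \<in> ring_iso (R\<lparr>carrier := S\<rparr>) (R\<lparr>carrier := S\<rparr>)"
    and scale: "\<And>c f. f \<in> S \<Longrightarrow> \<phi> (fscale c f) = fscale c (\<phi> f)"
    and Q: "\<phi> ` indicator ` B \<subseteq> indicator ` B"
    using \<phi> unfolding schur_iso_def basic_quantities_def B_def by blast+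
  then have bij: "bij_betw \<phi> S S" and one: "\<phi> \<one>\<^bsub>R\<^esub> = \<one>\<^bsub>R\<^esub>"
    and mult: "\<And>x y. x \<in> S \<Longrightarrow> y \<in> S \<Longrightarrow> \<phi> (x \<otimes>\<^bsub>R\<^esub> y) = \<phi> x \<otimes>\<^bsub>R\<^esub> \<phi> y"
    and add_R: "\<And>x y. x \<in> S \<Longrightarrow> y \<in> S \<Longrightarrow> \<phi> (x \<oplus>\<^bsub>R\<^esub> y) = \<phi> x \<oplus>\<^bsub>R\<^esub> \<phi> y"
    unfolding ring_iso_restrict_carrier by blast+
  have add: "\<phi> (x + y) = \<phi> x + \<phi> y" if "x \<in> S" "y \<in> S" for x y
    using add_R[OF that] by (simp add: group_algebra_def)
  have inj: "inj_on \<phi> S" using bij by (rule bij_betw_imp_inj_on)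
  have vs: "fvec.subspace S" using schur_ring by (simp add: schur_ring_def)
  have Q_eq: "\<phi> ` indicator ` B = indicator ` B"
  proof (rule endo_inj_surj[OF _ Q])
    show "finite (indicator ` B :: (int \<Rightarrow> 'f) set)" using finite_B by simp
    show "inj_on \<phi> (indicator ` B)" by (rule inj_on_subset[OF inj]) (use indicator_in_S in blast)
  qed
  have "\<exists>c. \<exists>C\<in>B. \<exists>D\<in>B. \<phi> (indicator C) = indicator D \<and> x \<in> D \<and> c \<in> C" if x: "x \<in> {0..<N}" for x
  proof -
    obtain D where D: "D \<in> B" "x \<in> D" using class_exists[OF x] .
    have "(indicator D :: int \<Rightarrow> 'f) \<in> \<phi> ` indicator ` B" unfolding Q_eq by (rule imageI[OF D(1)])
    then obtain C where C: "C \<in> B" "\<phi> (indicator C) = indicator D" by (metis imageE)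
    then obtain c where "c \<in> C" using partition_onD3[OF partition] by (metis all_not_in_conv)
    then show ?thesis using C D by blast
  qed
  then obtain c where c: "\<And>x. x \<in> {0..<N} \<Longrightarrow>
      \<exists>C\<in>B. \<exists>D\<in>B. \<phi> (indicator C) = indicator D \<and> x \<in> D \<and> c x \<in> C"
    by metis
  define \<tau> where "\<tau> x = c (x mod N)" for x
  have \<tau>: "\<exists>C\<in>B. \<exists>D\<in>B. \<phi> (indicator C) = indicator D \<and> x mod N \<in> D \<and> \<tau> x \<in> C" for x
    unfolding \<tau>_def using c[of "x mod N"] n_pos by simp
  have range: "\<tau> x \<in> {0..<N}" for x using \<tau>[of x] class_subset by blast
  have \<tau>_cong: "\<tau> x = \<tau> y" if "x mod N = y mod N" for x y using that by (simp add: \<tau>_def)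
  have base: "\<phi> (indicator C) x = indicator C (\<tau> x)" if C: "C \<in> B" and x: "x \<in> {0..<N}" for C x
  proof -
    obtain C' D' where C': "C' \<in> B" "D' \<in> B" "\<phi> (indicator C') = indicator D'" "x \<in> D'" "\<tau> x \<in> C'"
      using \<tau>[of x] x by auto
    obtain D where D: "D \<in> B" "\<phi> (indicator C) = indicator D" using Q C by blast
    have "x \<in> D \<longleftrightarrow> D = D'" using class_unique D(1) C'(2,4) by blast
    also have "\<dots> \<longleftrightarrow> C = C'"
    proof
      assume "D = D'"
      then have "\<phi> (indicator C) = \<phi> (indicator C')" using D(2) C'(3) by simp
      then have "(indicator C :: int \<Rightarrow> 'f) = indicator C'"
        using inj_onD[OF inj] indicator_in_S C C'(1) by blast
      then show "C = C'" by (rule indicator_inj)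
    next
      assume "C = C'"
      then have "(indicator D :: int \<Rightarrow> 'f) = indicator D'" using D(2) C'(3) by simp
      then show "D = D'" by (rule indicator_inj)
    qed
    also have "\<dots> \<longleftrightarrow> \<tau> x \<in> C" using class_unique C C'(1,5) by blast
    finally show ?thesis unfolding D(2) by (simp add: indicator_def)
  qed
  have act: "\<phi> g x = g (\<tau> x)" if "g \<in> S" and x: "x \<in> {0..<N}" for g x
  proof -
    have "g \<in> fvec.span (indicator ` B)" using that(1) span by simp
    \<comment> \<open>Membership in S is carried along because \<open>\<phi>\<close> is additive
      only on S.\<close>
    then have "g \<in> S \<and> \<phi> g x = g (\<tau> x)"
    proof (induction rule: fvec.span_induct_alt)
      case base
      have 0: "0 \<in> S" by (rule fvec.subspace_0[OF vs])
      then have "\<phi> (fscale 0 0) = fscale 0 (\<phi> 0)" by (rule scale)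
      then show ?case using 0 by (simp add: fscale_def zero_fun_def)
    next
      case (step k b g)
      then obtain C where C: "C \<in> B" "b = indicator C" by blast
      have b: "b \<in> S" using indicator_in_S C by simp
      have kb: "fscale k b \<in> S" by (rule fvec.subspace_scale[OF vs b])
      have "\<phi> (fscale k b + g) = fscale k (\<phi> b) + \<phi> g"
        using add[OF kb] scale[OF b] step(2) by simp
      then have "\<phi> (fscale k b + g) x = k * \<phi> b x + \<phi> g x"
        by (simp only: plus_fun_apply fscale_def)
      also have "\<dots> = (fscale k b + g) (\<tau> x)"
        using step(2) base[OF C(1) x] C(2) by (simp add: fscale_def)
      finally show ?case using fvec.subspace_add[OF vs kb] step(2) by blast
    qed
    then show ?thesis by simp
  qed
  have vanish: "\<phi> g x = 0" if "g \<in> S" "x \<notin> {0..<N}" for g x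
    using S_vanish[OF _ that(2)] bij_betw_apply[OF bij that(1)] by blast
  interpret schur_family N M by (rule schur_family)
  have per: "periodic N (\<lambda>x. f (\<tau> x))" for f :: "int \<Rightarrow> int"
    by (rule periodicI) (rule arg_cong[OF \<tau>_cong])
  have act_lift: "\<phi> (lift f) = lift (\<lambda>x. f (\<tau> x))" if f: "f \<in> M" for f
  proof
    fix x show "\<phi> (lift f) x = lift (\<lambda>x. f (\<tau> x)) x"
      using act[OF lift_in_S[OF f], of x] vanish[OF lift_in_S[OF f], of x] range[of x]
      by (auto simp: lift_def)
  qed
  have closed: "(\<lambda>x. f (\<tau> x)) \<in> M" if f: "f \<in> M" for f
    by (rule M_I[OF per]) (use act_lift[OF f] bij_betw_apply[OF bij lift_in_S[OF f]] in simp)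
  have "schur_automorphism N M \<tau>"
  proof unfold_locales
    show "(\<lambda>x. f (\<tau> x)) \<in> M" if "f \<in> M" for f using closed that .
  next
    fix f g x assume f: "f \<in> M" and g: "g \<in> M"
    let ?h = "conv N (\<lambda>x. f (\<tau> x)) (\<lambda>x. g (\<tau> x))"
    have "lift (\<lambda>x. conv N f g (\<tau> x)) = \<phi> (lift f \<otimes>\<^bsub>R\<^esub> lift g)"
      using act_lift[OF conv[OF f g]] lift_mult[OF periodic[OF f] periodic[OF g]] by simp
    also have "\<dots> = lift ?h"
      using mult[OF lift_in_S[OF f] lift_in_S[OF g]] act_lift[OF f] act_lift[OF g]
        lift_mult[OF per per, of f g] by simp
    finally have "conv N f g (\<tau> (x mod N)) = ?h (x mod N)"
      unfolding lift_eq_iff using n_pos by auto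
    moreover have "?h (x mod N) = ?h x" by (rule periodicD[OF periodic_conv[OF per]]) simp
    ultimately show "conv N f g (\<tau> x) = ?h x" using \<tau>_cong[of "x mod N" x] by simp
  next
    fix x
    have "\<phi> (indicator {0}) = indicator {0}" using one by (simp add: group_algebra_def)
    then have "(indicator {0} (x mod N) :: 'f) = indicator {0} (\<tau> x)"
      using act[OF indicator_in_S[OF zero_class], of "x mod N"] \<tau>_cong[of "x mod N" x] n_pos by simp
    then have "x mod N = 0 \<longleftrightarrow> \<tau> x = 0"
      unfolding indicator_def of_bool_eq_iff by simp
    then show "N dvd \<tau> x \<longleftrightarrow> N dvd x"
      using range[of x] by (simp add: dvd_eq_mod_eq_0)
  qed
  then show ?thesis using range act by blast
qed

lemma automorphisms_commute:
  assumes \<phi>: "\<phi> \<in> schur_iso G S G S" and \<psi>: "\<psi> \<in> schur_iso G S G S" and g: "g \<in> S"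
  shows "\<phi> (\<psi> g) = \<psi> (\<phi> g)"
proof
  fix x
  have maps: "k h \<in> S" if "k \<in> schur_iso G S G S" "h \<in> S" for k h
    using that bij_betw_apply[of k S S h] by (auto simp: schur_iso_def ring_iso_restrict_carrier)
  obtain \<tau> where \<tau>_aut: "schur_automorphism N M \<tau>"
    and \<tau>: "\<forall>x. \<tau> x \<in> {0..<N}" "\<forall>g\<in>S. \<forall>x\<in>{0..<N}. \<phi> g x = g (\<tau> x)"
    using automorphism_induced[OF \<phi>] by metis
  obtain \<sigma> where \<sigma>_aut: "schur_automorphism N M \<sigma>"
    and \<sigma>: "\<forall>x. \<sigma> x \<in> {0..<N}" "\<forall>g\<in>S. \<forall>x\<in>{0..<N}. \<psi> g x = g (\<sigma> x)"
    using automorphism_induced[OF \<psi>] by metis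
  show "\<phi> (\<psi> g) x = \<psi> (\<phi> g) x"
  proof (cases "x \<in> {0..<N}")
    case True
    have st: "\<sigma> (\<tau> x) \<in> {0..<N}" and ts: "\<tau> (\<sigma> x) \<in> {0..<N}"
      using \<sigma>(1) \<tau>(1) by blast+
    obtain C where C: "C \<in> B" "\<sigma> (\<tau> x) \<in> C" using class_exists[OF st] .
    \<comment> \<open>As g has values in the field, the integer result is applied to the indicator
      of the basic set of \<open>\<sigma>\<close> (\<open>\<tau>\<close> x), on which g is
      constant.\<close>
    define f :: "int \<Rightarrow> int" where "f y = of_bool (y mod N \<in> C)" for y
    have "lift f = indicator C"
      using class_subset[OF C(1)] by (auto simp: fun_eq_iff lift_def f_def indicator_def)
    then have "f \<in> M"
      using indicator_in_S[OF C(1)] by (intro M_I periodicI) (simp_all add: f_def)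
    then have "f (\<tau> (\<sigma> x)) = f (\<sigma> (\<tau> x))"
      by (rule schur_automorphisms_commute[OF \<tau>_aut \<sigma>_aut])
    then have "\<tau> (\<sigma> x) \<in> C" using C(2) st ts by (simp add: f_def)
    then have "g (\<sigma> (\<tau> x)) = g (\<tau> (\<sigma> x))" using S_constant[OF g C(1,2)] by simp
    moreover have "\<phi> (\<psi> g) x = g (\<sigma> (\<tau> x))"
      using \<tau> \<sigma>(2) maps[OF \<psi> g] g True by metis
    moreover have "\<psi> (\<phi> g) x = g (\<tau> (\<sigma> x))"
      using \<sigma> \<tau>(2) maps[OF \<phi> g] g True by metis
    ultimately show ?thesis by simp
  next
    case False
    then show ?thesis using S_vanish maps \<phi> \<psi> g by metis
  qed
qed

end

theorem theorem5p5:
  fixes n :: nat and S :: "(int \<Rightarrow> 'f::field_char_0) set"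
  assumes "n > 0"
    and "schur_ring (integer_mod_group n) S"
  shows "comm_group (schur_Aut (integer_mod_group n) S)"
proof -
  interpret cyclic_schur_ring n S using assms by unfold_locales
  have "group (schur_Aut (integer_mod_group n) S)"
    by (rule group_schur_Aut[OF assms(2)]) (use assms(1) in \<open>simp add: carrier_integer_mod_group\<close>)
  then show ?thesis
  proof (rule group.group_comm_groupI)
    fix \<phi> \<psi>
    assume "\<phi> \<in> carrier (schur_Aut (integer_mod_group n) S)"
      "\<psi> \<in> carrier (schur_Aut (integer_mod_group n) S)"
    then have *: "\<phi> \<in> Bij S" "\<phi> \<in> schur_iso G S G S" "\<psi> \<in> Bij S" "\<psi> \<in> schur_iso G S G S"
      by (auto simp: schur_Aut_def)
    have "compose S \<phi> \<psi> = compose S \<psi> \<phi>"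
      using automorphisms_commute[OF *(2,4)] by (auto simp: compose_def fun_eq_iff)
    then show "\<phi> \<otimes>\<^bsub>schur_Aut (integer_mod_group n) S\<^esub> \<psi> = \<psi> \<otimes>\<^bsub>schur_Aut (integer_mod_group n) S\<^esub> \<phi>"
      using * by (simp add: schur_Aut_def BijGroup_def)
  qed
qed

end
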